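(* Let $a\in(-1,0)\cup(0,\infty)$, $(p_0,q_0)\in\mathbb{R}^2$ and let $(\varepsilon,x,y,z)\mapsto H_{\varepsilon}(x,y,z)$ be a mapping in $C^{1}(\mathbb{R}\times\mathbb{R}^{3})$ satisfying $H_0(x,y,z)=1$ for all $(x,y,z)\in\mathbb{R}^3$. (i) If $T=T_{a,0}$ and $$\left.\frac{\partial H_\varepsilon}{\partial\varepsilon}(x,y,z)\right|_{\varepsilon=0}\ne0\quad\forall(x,y,z)\in\mathbb{R}^3,$$ then there cannot exist $\bar\varepsilon>0$, a continuous mapping $\varepsilon\mapsto(p_\varepsilon,q_\varepsilon)\in\mathbb{R}^2$ and a $C^1$-mapping $\varepsilon\mapsto\varphi_\varepsilon\in C^2([-T,T]\times\mathbb{S}^1)$, with $|\varepsilon|\le\bar\varepsilon$, such that $(p_\varepsilon,q_\varepsilon)|_{\varepsilon=0}=(p_0,q_0)$, $\varphi_0=0$ and for every $\varepsilon\in(-\bar\varepsilon,\bar\varepsilon)$ the triple $(p_\varepsilon,q_\varepsilon,\varphi_\varepsilon)$ solves $$\left\{\begin{array}{l}\mathfrak{M}(X_{a}+p_\varepsilon\mathbf{e}_{1}+q_\varepsilon\mathbf{e}_{2}+\varphi_{\varepsilon}N_{a})=H_{\varepsilon}(X_{a}+p_\varepsilon\mathbf{e}_{1}+q_\varepsilon\mathbf{e}_{2}+\varphi_{\varepsilon}N_{a})\ \text{ in }[-T,T]\times\mathbb{S}^{1}\\ \varphi_{\varepsilon}(\pm T,\cdot)=0\,.\end{array}\right.$$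 (ii) If $T=T_{a,k}$ with $k\ge1$, and $$\int_{[-T_{a,k},T_{a,k}]\times[-\pi,\pi]}x_a^2\,\overline{w}_{a,0}\left.\frac{\partial H_\varepsilon}{\partial\varepsilon}(X_a+p_0\mathbf{e}_1+q_0\mathbf{e}_2)\right|_{\varepsilon=0}dt\,d\theta\ne0,$$ where $\overline{w}_{a,0}$ is a nontrivial even solution, depending just on $t$, of $\mathfrak{L}_a\varphi=0$ in $[-T,T]\times\mathbb{S}^1$, $\varphi\in\mathcal{X}_T$, then the same conclusion as in (i) (non-existence of such $\bar\varepsilon$, $(p_\varepsilon,q_\varepsilon)$, $\varphi_\varepsilon$, now with $T=T_{a,k}$) holds true.
   Context: For $a\in(-1,0)\cup(0,\infty)$ put $\gamma_a:=a(1+a)$ and let $(x_a,z_a)$ be the solution on $\mathbb{R}$ of $x''=(1+2\gamma_a)x-2x^3$, $z'=x^2-\gamma_a$, $x(0)=1+a$, $x'(0)=0$, $z(0)=0$. The function $x_a$ is even, positive and periodic, and $x_a=\sqrt{(x_a')^2+(z_a')^2}$. Let $\mathbb{S}^1=\mathbb{R}/2\pi\mathbb{Z}$, $\mathbf{e}_1,\mathbf{e}_2,\mathbf{e}_3$ the canonical basis of $\mathbb{R}^3$, and $X_a(t,\theta)=(x_a(t)\cos\theta,x_a(t)\sin\theta,z_a(t))$ (a Delaunay surface of constant mean curvature $1$), with Gauss map $N_a=\frac{\partial_tX_a\wedge\partial_\theta X_a}{|\partial_tX_a\wedge\partial_\theta X_a|}$, where $\wedge$ is the cross product in $\mathbb{R}^3$.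 For a regular parametrized surface $X(t,\theta)$ (i.e. $X_t\wedge X_\theta\neq0$ everywhere) with normal $N=\frac{X_t\wedge X_\theta}{|X_t\wedge X_\theta|}$ the mean curvature is $\mathfrak{M}(X)=\frac{\mathcal{E}\mathcal{N}-2\mathcal{F}\mathcal{M}+\mathcal{G}\mathcal{L}}{2(\mathcal{E}\mathcal{G}-\mathcal{F}^2)}$, with $\mathcal{E}=|X_t|^2$, $\mathcal{F}=X_t\cdot X_\theta$, $\mathcal{G}=|X_\theta|^2$, $\mathcal{L}=X_{tt}\cdot N$, $\mathcal{M}=X_{t\theta}\cdot N$, $\mathcal{N}=X_{\theta\theta}\cdot N$. The Jacobi operator is $\mathfrak{L}_a\varphi:=\frac{\partial}{\partial s}[\mathfrak{M}(X_a+s\varphi N_a)]\big|_{s=0}$; explicitly $\mathfrak{L}_a\varphi=\frac{1}{2x_a^2}(\varphi_{tt}+\varphi_{\theta\theta}+2p_a\varphi)$ with $p_a=x_a^2+\gamma_a^2/x_a^2$. Fix $\alpha\in(0,1)$. For $T>0$, $\mathcal{X}_T:=\{\varphi\in C^{2,\alpha}([-T,T]\times\mathbb{S}^1,\mathbb{R})\mid\varphi(\pm T,\cdot)=0,\ \varphi(t,\cdot)=\varphi(-t,\cdot)\ \forall t\in[-T,T]\}$. The numbers $T_{a,k}$: let $\mathcal{T}_{a,0}$ be the set of $T>0$ for which there is a nonzero even function $w\in C^2(\mathbb{R})$ such that $\varphi(t,\theta)=w(t)$ satisfies $\mathfrak{L}_a\varphi=0$ on $\mathbb{R}\times\mathbb{S}^1$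 (i.e. $w''+2p_aw=0$) and $w(T)=0$. This set is infinite and discrete, and its elements are enumerated increasingly as $T_{a,0}<T_{a,1}<T_{a,2}<\cdots$. *)

theory Defs
  imports "HOL-Analysis.Analysis"
begin

text \<open>Functions on \<open>I \<times> S\<^sup>1\<close>, with \<open>I\<close> an interval, are curried functions of
  \<open>(t, \<theta>)\<close> that are \<open>2\<pi>\<close>-periodic in \<open>\<theta>\<close>. Derivatives in \<open>t\<close> are taken within \<open>I\<close>, hence
  are one-sided at the end points of \<open>I\<close>; values at \<open>t \<notin> I\<close> play no role.\<close>

definition Dt :: "real set \<Rightarrow> (real \<Rightarrow> real \<Rightarrow> 'a::real_normed_vector) \<Rightarrow> real \<Rightarrow> real \<Rightarrow> 'a" where
  "Dt I f t \<theta> = vector_derivative (\<lambda>s. f s \<theta>) (at t within I)"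

definition Dtheta :: "(real \<Rightarrow> real \<Rightarrow> 'a::real_normed_vector) \<Rightarrow> real \<Rightarrow> real \<Rightarrow> 'a" where
  "Dtheta f t \<theta> = vector_derivative (\<lambda>s. f t s) (at \<theta>)"


section \<open>Function spaces\<close>

definition C1_strip :: "real set \<Rightarrow> (real \<Rightarrow> real \<Rightarrow> real) \<Rightarrow> bool" where
  "C1_strip I f \<longleftrightarrow>
     (\<forall>t\<in>I. \<forall>\<theta>. (\<lambda>s. f s \<theta>) differentiable (at t within I) \<and> (\<lambda>s. f t s) differentiable (at \<theta>)) \<and>
     continuous_on (I \<times> UNIV) (\<lambda>(t, \<theta>). f t \<theta>) \<and>
     continuous_on (I \<times> UNIV) (\<lambda>(t, \<theta>). Dt I f t \<theta>) \<and>
     continuous_on (I \<times> UNIV) (\<lambda>(t, \<theta>). Dtheta f t \<theta>)"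

text \<open>\<open>C\<^sup>2(I \<times> S\<^sup>1)\<close>, up to the boundary of \<open>I\<close>.\<close>

definition C2_cyl :: "real set \<Rightarrow> (real \<Rightarrow> real \<Rightarrow> real) \<Rightarrow> bool" where
  "C2_cyl I f \<longleftrightarrow>
     (\<forall>t\<in>I. \<forall>\<theta>. f t (\<theta> + 2 * pi) = f t \<theta>) \<and>
     C1_strip I f \<and> C1_strip I (Dt I f) \<and> C1_strip I (Dtheta f)"

definition sup_norm :: "real set \<Rightarrow> (real \<Rightarrow> real \<Rightarrow> real) \<Rightarrow> real" where
  "sup_norm I f = (SUP (t, \<theta>)\<in>I \<times> UNIV. \<bar>f t \<theta>\<bar>)"

definition C2_norm :: "real set \<Rightarrow> (real \<Rightarrow> real \<Rightarrow> real) \<Rightarrow> real" where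
  "C2_norm I f =
     sup_norm I f + sup_norm I (Dt I f) + sup_norm I (Dtheta f) +
     sup_norm I (Dt I (Dt I f)) + sup_norm I (Dtheta (Dt I f)) + sup_norm I (Dtheta (Dtheta f))"

text \<open>Continuously (Frechet) differentiable maps from the interval \<open>J\<close> into the Banach space
  \<open>C\<^sup>2(I \<times> S\<^sup>1)\<close>; \<open>\<Psi>\<close> is the derivative of \<open>\<Phi>\<close>.\<close>

definition C1_curve_in_C2 :: "real set \<Rightarrow> real set \<Rightarrow> (real \<Rightarrow> real \<Rightarrow> real \<Rightarrow> real) \<Rightarrow> bool" where
  "C1_curve_in_C2 J I \<Phi> \<longleftrightarrow>
     (\<forall>e\<in>J. C2_cyl I (\<Phi> e)) \<and>
     (\<exists>\<Psi>. (\<forall>e\<in>J. C2_cyl I (\<Psi> e)) \<and>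
       (\<forall>e\<in>J. ((\<lambda>d. C2_norm I (\<lambda>t \<theta>. (\<Phi> d t \<theta> - \<Phi> e t \<theta>) / (d - e) - \<Psi> e t \<theta>)) \<longlongrightarrow> 0)
                 (at e within J)) \<and>
       (\<forall>e\<in>J. ((\<lambda>d. C2_norm I (\<lambda>t \<theta>. \<Psi> d t \<theta> - \<Psi> e t \<theta>)) \<longlongrightarrow> 0) (at e within J)))"

text \<open>For \<open>2\<pi>\<close>-periodic functions, Hoelder continuity on \<open>I \<times> \<real>\<close> and on
  \<open>I \<times> S\<^sup>1\<close> coincide.\<close>

definition holder_strip :: "real \<Rightarrow> real set \<Rightarrow> (real \<Rightarrow> real \<Rightarrow> real) \<Rightarrow> bool" where
  "holder_strip \<alpha> I f \<longleftrightarrow>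
     (\<exists>C. \<forall>t\<in>I. \<forall>t'\<in>I. \<forall>\<theta> \<theta>'. \<bar>f t \<theta> - f t' \<theta>'\<bar> \<le> C * dist (t, \<theta>) (t', \<theta>') powr \<alpha>)"

definition C2_holder_cyl :: "real \<Rightarrow> real set \<Rightarrow> (real \<Rightarrow> real \<Rightarrow> real) \<Rightarrow> bool" where
  "C2_holder_cyl \<alpha> I f \<longleftrightarrow>
     C2_cyl I f \<and> holder_strip \<alpha> I (Dt I (Dt I f)) \<and>
     holder_strip \<alpha> I (Dtheta (Dt I f)) \<and> holder_strip \<alpha> I (Dtheta (Dtheta f))"

definition X_space :: "real \<Rightarrow> real \<Rightarrow> (real \<Rightarrow> real \<Rightarrow> real) set" where
  "X_space \<alpha> T = {\<phi>. C2_holder_cyl \<alpha> {-T..T} \<phi> \<and>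
     (\<forall>\<theta>. \<phi> T \<theta> = 0 \<and> \<phi> (-T) \<theta> = 0) \<and> (\<forall>t\<in>{-T..T}. \<forall>\<theta>. \<phi> t \<theta> = \<phi> (-t) \<theta>)}"

definition C1_map :: "('a::real_normed_vector \<Rightarrow> 'b::real_normed_vector) \<Rightarrow> bool" where
  "C1_map f \<longleftrightarrow> (\<exists>D :: 'a \<Rightarrow> 'a \<Rightarrow>\<^sub>L 'b.
     (\<forall>v. (f has_derivative blinfun_apply (D v)) (at v)) \<and> continuous_on UNIV D)"


section \<open>Mean curvature of parametrized surfaces\<close>

definition normal_field :: "real set \<Rightarrow> (real \<Rightarrow> real \<Rightarrow> real^3) \<Rightarrow> real \<Rightarrow> real \<Rightarrow> real^3" where
  "normal_field I X t \<theta> = cross3 (Dt I X t \<theta>) (Dtheta X t \<theta>)"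

definition unit_normal :: "real set \<Rightarrow> (real \<Rightarrow> real \<Rightarrow> real^3) \<Rightarrow> real \<Rightarrow> real \<Rightarrow> real^3" where
  "unit_normal I X t \<theta> = normal_field I X t \<theta> /\<^sub>R norm (normal_field I X t \<theta>)"

definition regular_surface :: "real set \<Rightarrow> (real \<Rightarrow> real \<Rightarrow> real^3) \<Rightarrow> bool" where
  "regular_surface I X \<longleftrightarrow> (\<forall>t\<in>I. \<forall>\<theta>. normal_field I X t \<theta> \<noteq> 0)"

definition mean_curvature :: "real set \<Rightarrow> (real \<Rightarrow> real \<Rightarrow> real^3) \<Rightarrow> real \<Rightarrow> real \<Rightarrow> real" where
  "mean_curvature I X t \<theta> =
     (let Xt = Dt I X t \<theta>; Xh = Dtheta X t \<theta>; n = unit_normal I X t \<theta>;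
          E = (norm Xt)\<^sup>2; F = Xt \<bullet> Xh; G = (norm Xh)\<^sup>2;
          L = Dt I (Dt I X) t \<theta> \<bullet> n; M = Dtheta (Dt I X) t \<theta> \<bullet> n;
          N = Dtheta (Dtheta X) t \<theta> \<bullet> n
      in (E * N - 2 * F * M + G * L) / (2 * (E * G - F\<^sup>2)))"


section \<open>Delaunay surfaces\<close>

definition delaunay_gamma :: "real \<Rightarrow> real" where
  "delaunay_gamma a = a * (1 + a)"

definition delaunay_profile :: "real \<Rightarrow> (real \<Rightarrow> real) \<Rightarrow> (real \<Rightarrow> real) \<Rightarrow> bool" where
  "delaunay_profile a x z \<longleftrightarrow>
     (\<forall>t. (x has_real_derivative deriv x t) (at t)) \<and>
     (\<forall>t. (deriv x has_real_derivative (1 + 2 * delaunay_gamma a) * x t - 2 * (x t) ^ 3) (at t)) \<and>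
     (\<forall>t. (z has_real_derivative (x t)\<^sup>2 - delaunay_gamma a) (at t)) \<and>
     x 0 = 1 + a \<and> deriv x 0 = 0 \<and> z 0 = 0"

definition delaunay_surface :: "(real \<Rightarrow> real) \<Rightarrow> (real \<Rightarrow> real) \<Rightarrow> real \<Rightarrow> real \<Rightarrow> real^3" where
  "delaunay_surface x z t \<theta> = vector [x t * cos \<theta>, x t * sin \<theta>, z t]"

definition delaunay_normal :: "(real \<Rightarrow> real) \<Rightarrow> (real \<Rightarrow> real) \<Rightarrow> real \<Rightarrow> real \<Rightarrow> real^3" where
  "delaunay_normal x z = unit_normal UNIV (delaunay_surface x z)"

definition perturbed_surface ::
  "(real \<Rightarrow> real) \<Rightarrow> (real \<Rightarrow> real) \<Rightarrow> real \<Rightarrow> real \<Rightarrow> (real \<Rightarrow> real \<Rightarrow> real) \<Rightarrow> real \<Rightarrow> real \<Rightarrow> real^3" where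
  "perturbed_surface x z p q \<phi> t \<theta> =
     delaunay_surface x z t \<theta> + p *\<^sub>R axis 1 1 + q *\<^sub>R axis 2 1 + \<phi> t \<theta> *\<^sub>R delaunay_normal x z t \<theta>"

definition jacobi_op ::
  "real set \<Rightarrow> (real \<Rightarrow> real) \<Rightarrow> (real \<Rightarrow> real) \<Rightarrow> (real \<Rightarrow> real \<Rightarrow> real) \<Rightarrow> real \<Rightarrow> real \<Rightarrow> real" where
  "jacobi_op I x z \<phi> t \<theta> =
     deriv (\<lambda>s. mean_curvature I
       (\<lambda>t \<theta>. delaunay_surface x z t \<theta> + (s * \<phi> t \<theta>) *\<^sub>R delaunay_normal x z t \<theta>) t \<theta>) 0"

definition T_set :: "(real \<Rightarrow> real) \<Rightarrow> (real \<Rightarrow> real) \<Rightarrow> real set" where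
  "T_set x z = {T. T > 0 \<and>
     (\<exists>w. w C1_differentiable_on UNIV \<and> deriv w C1_differentiable_on UNIV \<and>
          (\<forall>t. w (-t) = w t) \<and> (\<exists>t. w t \<noteq> 0) \<and>
          (\<forall>t \<theta>. jacobi_op UNIV x z (\<lambda>t \<theta>. w t) t \<theta> = 0) \<and> w T = 0)}"

text \<open>The increasing enumeration \<open>T\<^sub>0 < T\<^sub>1 < T\<^sub>2 < \<dots>\<close> of the infinite discrete set
  \<open>T_set x z\<close>; these two conditions determine \<open>Ts\<close> uniquely.\<close>

definition T_enumeration :: "(real \<Rightarrow> real) \<Rightarrow> (real \<Rightarrow> real) \<Rightarrow> (nat \<Rightarrow> real) \<Rightarrow> bool" where
  "T_enumeration x z Ts \<longleftrightarrow> strict_mono Ts \<and> range Ts = T_set x z"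

definition even_jacobi_solution ::
  "real \<Rightarrow> (real \<Rightarrow> real) \<Rightarrow> (real \<Rightarrow> real) \<Rightarrow> real \<Rightarrow> (real \<Rightarrow> real) \<Rightarrow> bool" where
  "even_jacobi_solution \<alpha> x z T w \<longleftrightarrow>
     (\<lambda>t \<theta>. w t) \<in> X_space \<alpha> T \<and> (\<exists>t\<in>{-T..T}. w t \<noteq> 0) \<and>
     (\<forall>t\<in>{-T..T}. \<forall>\<theta>. jacobi_op {-T..T} x z (\<lambda>t \<theta>. w t) t \<theta> = 0)"


section \<open>The prescribed mean curvature problem\<close>

text \<open>Regularity of the surface is part of the equation, since the mean curvature is defined only
  for regular surfaces.\<close>

definition solves_H_problem ::
  "(real \<Rightarrow> real) \<Rightarrow> (real \<Rightarrow> real) \<Rightarrow> real \<Rightarrow> (real^3 \<Rightarrow> real) \<Rightarrow>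
   real \<Rightarrow> real \<Rightarrow> (real \<Rightarrow> real \<Rightarrow> real) \<Rightarrow> bool" where
  "solves_H_problem x z T h p q \<phi> \<longleftrightarrow>
     regular_surface {-T..T} (perturbed_surface x z p q \<phi>) \<and>
     (\<forall>t\<in>{-T..T}. \<forall>\<theta>. mean_curvature {-T..T} (perturbed_surface x z p q \<phi>) t \<theta> =
        h (perturbed_surface x z p q \<phi> t \<theta>)) \<and>
     (\<forall>\<theta>. \<phi> T \<theta> = 0 \<and> \<phi> (-T) \<theta> = 0)"

definition solution_branch ::
  "(real \<Rightarrow> real) \<Rightarrow> (real \<Rightarrow> real) \<Rightarrow> (real \<Rightarrow> real^3 \<Rightarrow> real) \<Rightarrow> real \<Rightarrow> real \<Rightarrow> real \<Rightarrow>
   real \<Rightarrow> (real \<Rightarrow> real) \<Rightarrow> (real \<Rightarrow> real) \<Rightarrow> (real \<Rightarrow> real \<Rightarrow> real \<Rightarrow> real) \<Rightarrow> bool" where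
  "solution_branch x z H T p0 q0 \<delta> p q \<phi> \<longleftrightarrow>
     continuous_on {-\<delta>..\<delta>} (\<lambda>\<epsilon>. (p \<epsilon>, q \<epsilon>)) \<and>
     C1_curve_in_C2 {-\<delta>..\<delta>} {-T..T} \<phi> \<and>
     (p 0, q 0) = (p0, q0) \<and> (\<forall>t\<in>{-T..T}. \<forall>\<theta>. \<phi> 0 t \<theta> = 0) \<and>
     (\<forall>\<epsilon>\<in>{-\<delta><..<\<delta>}. solves_H_problem x z T (H \<epsilon>) (p \<epsilon>) (q \<epsilon>) (\<phi> \<epsilon>))"

end

theory Submission
  imports Defs "HOL-Library.Periodic_Fun"
begin

text \<open>The mean curvature is translation invariant, so differentiating the equation along the
  branch at \<open>\<epsilon> = 0\<close> needs no differentiability of \<open>p\<close> and \<open>q\<close>: the derivative \<open>\<psi>\<close> of \<open>\<phi>\<close>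
  solves \<open>L \<psi> = h(X + p\<^sub>0 e\<^sub>1 + q\<^sub>0 e\<^sub>2)\<close> with \<open>\<psi>(\<plusminus>T, \<cdot>) = 0\<close>, where \<open>L\<close> is the Jacobi operator and
  \<open>h\<close> is the \<open>\<epsilon>\<close>-derivative of \<open>H\<close>. Testing with \<open>x\<^sup>2 w\<close>, for an even radial Jacobi field \<open>w\<close>
  vanishing at \<open>\<plusminus>T\<close>, and integrating by parts gives \<open>\<integral> x\<^sup>2 w h = 0\<close>. For the least \<open>T\<close> the field
  \<open>w\<close> has no zero in \<open>(0, T)\<close>, since such a zero would be a smaller element of the set; if
  moreover \<open>h\<close> never vanishes, the integrand has a constant sign and is not identically \<open>0\<close>.\<close>

section \<open>Functions on the cylinder\<close>

lemma Dt_eqI: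
  assumes "((\<lambda>s. f s \<theta>) has_vector_derivative d) (at t within I)" "at t within I \<noteq> bot"
  shows "Dt I f t \<theta> = d"
  unfolding Dt_def using vector_derivative_within[OF assms(2,1)] .

lemma Dtheta_eqI:
  assumes "((\<lambda>s. f t s) has_vector_derivative d) (at \<theta>)"
  shows "Dtheta f t \<theta> = d"
  unfolding Dtheta_def using vector_derivative_at[OF assms] .

text \<open>At a point of \<open>I\<close> the derivative within \<open>I\<close> sees only the
  values on \<open>I\<close>. Both sides choose from the same set of candidate derivatives, so the
  equality also covers points where no derivative exists.\<close>

lemma Dt_cong:
  assumes "\<And>s. s \<in> I \<Longrightarrow> f s \<theta> = g s \<theta>" "t \<in> I"
  shows "Dt I f t \<theta> = Dt I g t \<theta>"
  unfolding Dt_def vector_derivative_def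
  by (intro arg_cong[where f=Eps] ext iffI; erule has_vector_derivative_transform[OF assms(2), rotated])
     (simp_all add: assms(1))

lemma Dtheta_cong:
  assumes "\<And>s. f t s = g t s"
  shows "Dtheta f t \<theta> = Dtheta g t \<theta>"
proof -
  have "f t = g t" using assms by blast
  then show ?thesis unfolding Dtheta_def by simp
qed

lemma C1_strip_derivs:
  assumes "C1_strip I f" "t \<in> I"
  shows "((\<lambda>s. f s \<theta>) has_vector_derivative Dt I f t \<theta>) (at t within I)"
    "((\<lambda>s. f t s) has_vector_derivative Dtheta f t \<theta>) (at \<theta>)"
  unfolding Dt_def Dtheta_def using assms
  by (auto simp: C1_strip_def simp flip: vector_derivative_works)

lemma C2_cyl_derivs:
  assumes "C2_cyl I \<phi>" "t \<in> I"
  shows "((\<lambda>s. \<phi> s \<theta>) has_vector_derivative Dt I \<phi> t \<theta>) (at t within I)"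
    "((\<lambda>s. \<phi> t s) has_vector_derivative Dtheta \<phi> t \<theta>) (at \<theta>)"
    "((\<lambda>s. Dt I \<phi> s \<theta>) has_vector_derivative Dt I (Dt I \<phi>) t \<theta>) (at t within I)"
    "((\<lambda>s. Dt I \<phi> t s) has_vector_derivative Dtheta (Dt I \<phi>) t \<theta>) (at \<theta>)"
    "((\<lambda>s. Dtheta \<phi> s \<theta>) has_vector_derivative Dt I (Dtheta \<phi>) t \<theta>) (at t within I)"
    "((\<lambda>s. Dtheta \<phi> t s) has_vector_derivative Dtheta (Dtheta \<phi>) t \<theta>) (at \<theta>)"
  using assms unfolding C2_cyl_def by (auto intro: C1_strip_derivs)

text \<open>Formulas for \<open>Dt I\<close> are known only at points of \<open>I\<close>; this lets
  them replace the derivative inside \<open>C1_strip\<close>.\<close>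

lemma C1_strip_cong:
  assumes "\<And>t \<theta>. t \<in> I \<Longrightarrow> f t \<theta> = g t \<theta>"
  shows "C1_strip I f = C1_strip I g"
proof -
  have "C1_strip I g" if "C1_strip I f" and eq: "\<And>t \<theta>. t \<in> I \<Longrightarrow> f t \<theta> = g t \<theta>" for f g
  proof -
    have Dt: "Dt I f t \<theta> = Dt I g t \<theta>" if "t \<in> I" for t \<theta>
      using that eq by (intro Dt_cong) auto
    have Dh: "Dtheta f t \<theta> = Dtheta g t \<theta>" if "t \<in> I" for t \<theta>
      using that eq by (intro Dtheta_cong) auto
    have 1: "(\<lambda>s. g s \<theta>) differentiable (at t within I)" "(\<lambda>s. g t s) differentiable (at \<theta>)"
      if t: "t \<in> I" for t \<theta>
      by (rule differentiableI_vector,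
          rule has_vector_derivative_transform[OF t _ C1_strip_derivs(1)[OF \<open>C1_strip I f\<close> t]],
          use eq in simp)
         (use eq[OF t] C1_strip_derivs(2)[OF \<open>C1_strip I f\<close> t] in \<open>auto intro: differentiableI_vector\<close>)
    have 2: "continuous_on (I \<times> UNIV) (\<lambda>(t, \<theta>). F' t \<theta>)"
      if "\<And>t \<theta>. t \<in> I \<Longrightarrow> F t \<theta> = F' t \<theta>" "continuous_on (I \<times> UNIV) (\<lambda>(t, \<theta>). F t \<theta>)"
      for F F' :: "real \<Rightarrow> real \<Rightarrow> real"
      using that(2) by (rule continuous_on_eq) (use that(1) in auto)
    show ?thesis
      unfolding C1_strip_def using \<open>C1_strip I f\<close>[unfolded C1_strip_def] 1 2[OF eq] 2[OF Dt] 2[OF Dh]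
      by simp
  qed
  from this[of f g] this[of g f] show ?thesis using assms by metis
qed

text \<open>One operator for each summand of \<open>C2_norm\<close>, collected in a set so that
  linearity, periodicity, continuity and the bound by the norm are stated once for all six. The
  mixed derivative has the order used by \<open>mean_curvature\<close>.\<close>

definition jets :: "real set \<Rightarrow> ((real \<Rightarrow> real \<Rightarrow> real) \<Rightarrow> (real \<Rightarrow> real \<Rightarrow> real)) set" where
  "jets I = {\<lambda>f. f, Dt I, Dtheta, \<lambda>f. Dt I (Dt I f), \<lambda>f. Dtheta (Dt I f), \<lambda>f. Dtheta (Dtheta f)}"

lemma jets_cases [consumes 1]:
  assumes "J \<in> jets I"
  obtains "J = (\<lambda>f. f)" | "J = Dt I" | "J = Dtheta" | "J = (\<lambda>f. Dt I (Dt I f))"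
    | "J = (\<lambda>f. Dtheta (Dt I f))" | "J = (\<lambda>f. Dtheta (Dtheta f))"
  using assms unfolding jets_def by blast

section \<open>Linearity, periodicity and boundedness of the jet operators\<close>

context
  fixes I :: "real set"
  assumes I: "\<forall>t\<in>I. at t within I \<noteq> bot"
begin

text \<open>No point of \<open>I\<close> is isolated in \<open>I\<close>, so derivatives within
  \<open>I\<close> are unique and \<open>Dt I h\<close> can be read off from the sum rule. Both
  \<open>{-T..T}\<close> and the whole line are of this kind.\<close>

lemma
  fixes c d :: real
  assumes "C1_strip I f" "C1_strip I g"
  defines "h \<equiv> \<lambda>t \<theta>. c * f t \<theta> + d * g t \<theta>"
  shows Dt_lincomb: "t \<in> I \<Longrightarrow> Dt I h t \<theta> = c * Dt I f t \<theta> + d * Dt I g t \<theta>"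
    and Dtheta_lincomb: "t \<in> I \<Longrightarrow> Dtheta h t \<theta> = c * Dtheta f t \<theta> + d * Dtheta g t \<theta>"
    and C1_strip_lincomb: "C1_strip I h"
proof -
  note f = C1_strip_derivs[OF assms(1)] and g = C1_strip_derivs[OF assms(2)]
  note fr = f[folded has_real_derivative_iff_has_vector_derivative]
    g[folded has_real_derivative_iff_has_vector_derivative]
  have 1: "((\<lambda>s. h s \<theta>) has_vector_derivative c * Dt I f t \<theta> + d * Dt I g t \<theta>) (at t within I)"
    "((\<lambda>s. h t s) has_vector_derivative c * Dtheta f t \<theta> + d * Dtheta g t \<theta>) (at \<theta>)"
    if "t \<in> I" for t \<theta>
    unfolding has_real_derivative_iff_has_vector_derivative[symmetric] h_def
    by ((rule derivative_eq_intros fr that refl)+, simp)+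
  show Dt: "Dt I h t \<theta> = c * Dt I f t \<theta> + d * Dt I g t \<theta>" if "t \<in> I" for t \<theta>
    by (rule Dt_eqI[OF 1(1)[OF that] bspec[OF I that]])
  show Dh: "Dtheta h t \<theta> = c * Dtheta f t \<theta> + d * Dtheta g t \<theta>" if "t \<in> I" for t \<theta>
    by (rule Dtheta_eqI) (rule 1(2)[OF that])
  have c: "continuous_on (I \<times> UNIV) (\<lambda>(t, \<theta>). H t \<theta>)"
    if "\<And>t \<theta>. t \<in> I \<Longrightarrow> H t \<theta> = c * F t \<theta> + d * G t \<theta>"
      "continuous_on (I \<times> UNIV) (\<lambda>(t, \<theta>). F t \<theta>)" "continuous_on (I \<times> UNIV) (\<lambda>(t, \<theta>). G t \<theta>)"
      for F G H :: "real \<Rightarrow> real \<Rightarrow> real"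
  proof -
    have "continuous_on (I \<times> UNIV) (\<lambda>p. c * (\<lambda>(t, \<theta>). F t \<theta>) p + d * (\<lambda>(t, \<theta>). G t \<theta>) p)"
      by (intro continuous_intros that)
    then show ?thesis by (rule continuous_on_eq) (auto simp: that(1))
  qed
  show "C1_strip I h"
    unfolding C1_strip_def
  proof (intro conjI ballI allI)
    show "continuous_on (I \<times> UNIV) (\<lambda>(t, \<theta>). h t \<theta>)"
      by (rule c[of h f g]) (use assms(1,2) in \<open>simp_all add: h_def C1_strip_def\<close>)
    show "continuous_on (I \<times> UNIV) (\<lambda>(t, \<theta>). Dt I h t \<theta>)"
      by (rule c[OF Dt]) (use assms(1,2) in \<open>simp_all add: C1_strip_def\<close>)
    show "continuous_on (I \<times> UNIV) (\<lambda>(t, \<theta>). Dtheta h t \<theta>)"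
      by (rule c[OF Dh]) (use assms(1,2) in \<open>simp_all add: C1_strip_def\<close>)
  qed (rule 1[THEN differentiableI_vector]; assumption)+
qed

lemma C2_cyl_lincomb:
  assumes f: "C2_cyl I f" and g: "C2_cyl I g"
  shows "C2_cyl I (\<lambda>t \<theta>. c * f t \<theta> + d * g t \<theta>)" (is "C2_cyl I ?h")
proof -
  have s: "C1_strip I f" "C1_strip I g" "C1_strip I (Dt I f)" "C1_strip I (Dt I g)"
    "C1_strip I (Dtheta f)" "C1_strip I (Dtheta g)"
    using f g by (auto simp: C2_cyl_def)
  have "C1_strip I (Dt I ?h)"
    using C1_strip_cong[of I "Dt I ?h" "\<lambda>t \<theta>. c * Dt I f t \<theta> + d * Dt I g t \<theta>"]
      Dt_lincomb[OF s(1,2)] C1_strip_lincomb[OF s(3,4)] by simp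
  moreover have "C1_strip I (Dtheta ?h)"
    using C1_strip_cong[of I "Dtheta ?h" "\<lambda>t \<theta>. c * Dtheta f t \<theta> + d * Dtheta g t \<theta>"]
      Dtheta_lincomb[OF s(1,2)] C1_strip_lincomb[OF s(5,6)] by simp
  ultimately show ?thesis
    using C1_strip_lincomb[OF s(1,2)] f g by (auto simp: C2_cyl_def)
qed

lemma jet_lincomb:
  assumes "J \<in> jets I" and f: "C2_cyl I f" and g: "C2_cyl I g" and t: "t \<in> I"
  shows "J (\<lambda>t \<theta>. c * f t \<theta> + d * g t \<theta>) t \<theta> = c * J f t \<theta> + d * J g t \<theta>"
proof -
  let ?h = "\<lambda>t \<theta>. c * f t \<theta> + d * g t \<theta>"
  have s: "C1_strip I f" "C1_strip I g" "C1_strip I (Dt I f)" "C1_strip I (Dt I g)"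
    "C1_strip I (Dtheta f)" "C1_strip I (Dtheta g)"
    using f g by (auto simp: C2_cyl_def)
  have "Dt I (Dt I ?h) t \<theta> = Dt I (\<lambda>t \<theta>. c * Dt I f t \<theta> + d * Dt I g t \<theta>) t \<theta>"
    by (rule Dt_cong[OF _ t]) (rule Dt_lincomb[OF s(1,2)])
  moreover have "Dtheta (Dt I ?h) t \<theta> = Dtheta (\<lambda>t \<theta>. c * Dt I f t \<theta> + d * Dt I g t \<theta>) t \<theta>"
    by (rule Dtheta_cong) (rule Dt_lincomb[OF s(1,2) t])
  moreover have "Dtheta (Dtheta ?h) t \<theta> = Dtheta (\<lambda>t \<theta>. c * Dtheta f t \<theta> + d * Dtheta g t \<theta>) t \<theta>"
    by (rule Dtheta_cong) (rule Dtheta_lincomb[OF s(1,2) t])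
  ultimately show ?thesis
    using assms(1) Dt_lincomb[OF s(1,2) t] Dtheta_lincomb[OF s(1,2) t] Dt_lincomb[OF s(3,4) t]
      Dtheta_lincomb[OF s(3,4) t] Dtheta_lincomb[OF s(5,6) t]
    by (auto simp: jets_def)
qed

lemma Dt_periodic:
  assumes "\<And>t \<theta>. t \<in> I \<Longrightarrow> f t (\<theta> + 2 * pi) = f t \<theta>" "t \<in> I"
  shows "Dt I f t (\<theta> + 2 * pi) = Dt I f t \<theta>"
  using Dt_cong[of I "\<lambda>s \<theta>. f s (\<theta> + 2 * pi)" \<theta> f t] assms by (simp add: Dt_def)

lemma Dtheta_periodic:
  fixes f :: "real \<Rightarrow> real \<Rightarrow> real"
  assumes "\<And>\<theta>. f t (\<theta> + 2 * pi) = f t \<theta>"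
  shows "Dtheta f t (\<theta> + 2 * pi) = Dtheta f t \<theta>"
  using assms DERIV_shift[of "f t" _ \<theta> "2 * pi"]
  by (simp add: Dtheta_def vector_derivative_def flip: has_real_derivative_iff_has_vector_derivative)

lemma jet_periodic:
  assumes "J \<in> jets I" "C2_cyl I f" "t \<in> I"
  shows "J f t (\<theta> + 2 * pi) = J f t \<theta>"
proof -
  have 0: "\<And>t \<theta>. t \<in> I \<Longrightarrow> f t (\<theta> + 2 * pi) = f t \<theta>" using assms(2) by (simp add: C2_cyl_def)
  note 1 = Dt_periodic[of f, OF 0]
  note 2 = Dtheta_periodic[of f, OF 0]
  show ?thesis
    using assms(1,3) 0 1 2 Dt_periodic[of "Dt I f", OF 1] Dtheta_periodic[of "Dt I f", OF 1]
      Dtheta_periodic[of "Dtheta f", OF 2]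
    by (auto simp: jets_def)
qed

lemma jet_continuous:
  assumes "J \<in> jets I" "C2_cyl I f"
  shows "continuous_on (I \<times> UNIV) (\<lambda>(t, \<theta>). J f t \<theta>)"
  using assms by (auto simp: jets_def C2_cyl_def C1_strip_def)

text \<open>The supremum over an infinite strip is meaningful only for a bounded function.
  Periodicity in \<theta> reduces the range to that over the compact set
  \<open>I \<times> {0..2 * pi}\<close>, on which the jet is continuous.\<close>

lemma jet_le_sup_norm:
  assumes "compact I" "J \<in> jets I" "C2_cyl I f" "t \<in> I"
  shows "\<bar>J f t \<theta>\<bar> \<le> sup_norm I (J f)"
proof -
  let ?F = "\<lambda>(t, \<theta>). \<bar>J f t \<theta>\<bar>"
  have "continuous_on (I \<times> UNIV) ?F"
    using continuous_on_rabs[OF jet_continuous[OF assms(2,3)]] by (simp add: case_prod_unfold)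
  then have "continuous_on (I \<times> {0..2 * pi}) ?F"
    by (rule continuous_on_subset) auto
  then have "compact (?F ` (I \<times> {0..2 * pi}))"
    using assms(1) by (intro compact_continuous_image compact_Times) auto
  moreover have "?F ` (I \<times> UNIV) \<subseteq> ?F ` (I \<times> {0..2 * pi})"
  proof clarify
    fix t \<theta> :: real assume t: "t \<in> I"
    interpret periodic_fun_simple "J f t" "2 * pi"
      by standard (rule jet_periodic[OF assms(2,3) t])
    define \<theta>' where "\<theta>' = \<theta> - of_int \<lfloor>\<theta> / (2 * pi)\<rfloor> * (2 * pi)"
    have "\<bar>J f t \<theta>\<bar> = ?F (t, \<theta>')" by (simp add: \<theta>'_def minus_of_int)
    moreover have "\<theta>' \<in> {0..2 * pi}"
    proof -
      have "of_int \<lfloor>\<theta> / (2 * pi)\<rfloor> \<le> \<theta> / (2 * pi)" "\<theta> / (2 * pi) \<le> of_int \<lfloor>\<theta> / (2 * pi)\<rfloor> + 1"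
        by linarith+
      then show ?thesis
        by (simp add: \<theta>'_def le_divide_eq divide_le_eq pi_gt_zero algebra_simps)
    qed
    ultimately show "\<bar>J f t \<theta>\<bar> \<in> ?F ` (I \<times> {0..2 * pi})"
      using t by (intro image_eqI[where x = "(t, \<theta>')"]) auto
  qed
  ultimately have "bdd_above (?F ` (I \<times> UNIV))"
    by (meson bdd_above_mono bounded_imp_bdd_above compact_imp_bounded)
  then show ?thesis
    unfolding sup_norm_def using cSUP_upper[of "(t, \<theta>)" "I \<times> UNIV" ?F] assms(4)
    by (metis (no_types, lifting) UNIV_I case_prod_conv mem_Sigma_iff)
qed

lemma jet_le_C2_norm:
  assumes "compact I" "J \<in> jets I" "C2_cyl I f" "t \<in> I"
  shows "\<bar>J f t \<theta>\<bar> \<le> C2_norm I f"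
proof -
  have nonneg: "0 \<le> sup_norm I (J f)" if "J \<in> jets I" for J
    using jet_le_sup_norm[OF assms(1) that assms(3,4), of 0] by linarith
  have "0 \<le> sup_norm I f" "0 \<le> sup_norm I (Dt I f)" "0 \<le> sup_norm I (Dtheta f)"
    "0 \<le> sup_norm I (Dt I (Dt I f))" "0 \<le> sup_norm I (Dtheta (Dt I f))"
    "0 \<le> sup_norm I (Dtheta (Dtheta f))"
    by (rule nonneg[of "\<lambda>f. f"] nonneg[of "Dt I"] nonneg[of Dtheta] nonneg[of "\<lambda>f. Dt I (Dt I f)"]
      nonneg[of "\<lambda>f. Dtheta (Dt I f)"] nonneg[of "\<lambda>f. Dtheta (Dtheta f)"]; simp add: jets_def)+
  then have "sup_norm I (J f) \<le> C2_norm I f"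
    using assms(2) by (elim jets_cases) (simp_all add: C2_norm_def)
  then show ?thesis using jet_le_sup_norm[OF assms, of \<theta>] by linarith
qed

text \<open>The \<open>C2_norm\<close> of the error of the difference quotient dominates each jet of
  that error at each point. Hence every jet at a fixed point is differentiable in the parameter, and
  taking jets commutes with this derivative.\<close>

lemma C1_curve_jet_derivative:
  assumes "compact I" "\<delta> > 0" "C1_curve_in_C2 {-\<delta>..\<delta>} I \<Phi>"
  obtains \<psi> where "C2_cyl I \<psi>"
    "\<And>J t \<theta>. J \<in> jets I \<Longrightarrow> t \<in> I \<Longrightarrow> ((\<lambda>e. J (\<Phi> e) t \<theta>) has_real_derivative J \<psi> t \<theta>) (at 0)"
proof -
  obtain \<Psi> where cyls: "\<forall>e\<in>{-\<delta>..\<delta>}. C2_cyl I (\<Phi> e)" "\<forall>e\<in>{-\<delta>..\<delta>}. C2_cyl I (\<Psi> e)"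
    and lims: "\<forall>e\<in>{-\<delta>..\<delta>}. ((\<lambda>d. C2_norm I (\<lambda>t \<theta>. (\<Phi> d t \<theta> - \<Phi> e t \<theta>) / (d - e) - \<Psi> e t \<theta>)) \<longlongrightarrow> 0)
            (at e within {-\<delta>..\<delta>})"
    using assms(3) unfolding C1_curve_in_C2_def by (elim conjE exE) (rule that)
  have 0: "0 \<in> {-\<delta>..\<delta>}" using assms(2) by simp
  note cyl = cyls(1)[rule_format] and cyl' = cyls(2)[rule_format, OF 0] and lim = lims[rule_format, OF 0]
  \<comment> \<open>Since 0 is interior to the parameter interval, the limit within the interval is
    a full limit.\<close>
  have lim: "((\<lambda>d. C2_norm I (\<lambda>t \<theta>. (\<Phi> d t \<theta> - \<Phi> 0 t \<theta>) / (d - 0) - \<Psi> 0 t \<theta>)) \<longlongrightarrow> 0) (at 0)"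
    using lim at_within_Icc_at[of "-\<delta>" 0 \<delta>] assms(2) by simp
  show ?thesis
  proof
    fix J t \<theta> assume J: "J \<in> jets I" and t: "t \<in> I"
    have "\<forall>\<^sub>F d in at 0. d \<in> {-\<delta><..<\<delta>} - {0}"
      using assms(2) by (intro eventually_at_in_open) auto
    then have "\<forall>\<^sub>F d in at 0. norm ((J (\<Phi> d) t \<theta> - J (\<Phi> 0) t \<theta>) / (d - 0) - J (\<Psi> 0) t \<theta>)
       \<le> C2_norm I (\<lambda>t \<theta>. (\<Phi> d t \<theta> - \<Phi> 0 t \<theta>) / (d - 0) - \<Psi> 0 t \<theta>)"
    proof (rule eventually_mono)
      fix d assume d: "d \<in> {-\<delta><..<\<delta>} - {0}"
      \<comment> \<open>The error of the difference quotient is written as two nested linear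
        combinations, the form to which \<open>jet_lincomb\<close> applies.\<close>
      let ?f = "\<lambda>t \<theta>. (1 / d) * \<Phi> d t \<theta> + (- 1 / d) * \<Phi> 0 t \<theta>"
      let ?q = "\<lambda>t \<theta>. 1 * ?f t \<theta> + (- 1) * \<Psi> 0 t \<theta>"
      have c: "C2_cyl I (\<Phi> d)" "C2_cyl I (\<Phi> 0)" using d cyl assms(2) by auto
      then have f: "C2_cyl I ?f" by (rule C2_cyl_lincomb)
      then have q: "C2_cyl I ?q" using cyl' by (rule C2_cyl_lincomb)
      have "J ?q t \<theta> = (J (\<Phi> d) t \<theta> - J (\<Phi> 0) t \<theta>) / (d - 0) - J (\<Psi> 0) t \<theta>"
        unfolding jet_lincomb[OF J f cyl' t] jet_lincomb[OF J c t] by (simp add: diff_divide_distrib)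
      then have "norm ((J (\<Phi> d) t \<theta> - J (\<Phi> 0) t \<theta>) / (d - 0) - J (\<Psi> 0) t \<theta>) \<le> C2_norm I ?q"
        using jet_le_C2_norm[OF assms(1) J q t, of \<theta>] by simp
      also have "?q = (\<lambda>t \<theta>. (\<Phi> d t \<theta> - \<Phi> 0 t \<theta>) / (d - 0) - \<Psi> 0 t \<theta>)"
        by (simp add: diff_divide_distrib fun_eq_iff)
      finally show "norm ((J (\<Phi> d) t \<theta> - J (\<Phi> 0) t \<theta>) / (d - 0) - J (\<Psi> 0) t \<theta>)
         \<le> C2_norm I (\<lambda>t \<theta>. (\<Phi> d t \<theta> - \<Phi> 0 t \<theta>) / (d - 0) - \<Psi> 0 t \<theta>)" .
    qed
    from Lim_null_comparison[OF this lim]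
    show "((\<lambda>e. J (\<Phi> e) t \<theta>) has_real_derivative J (\<Psi> 0) t \<theta>) (at 0)"
      unfolding has_field_derivative_iff by (rule LIM_zero_cancel)
  qed (rule cyl')
qed

end

text \<open>As \<open>H 0\<close> is constant, \<open>H e (V e) - H 0 (V 0)\<close> equals
  \<open>H e (V e) - H 0 (V e)\<close>, an increment in the parameter alone. By the mean value
  theorem it is \<open>e\<close> times a partial derivative at an intermediate parameter, which
  converges by joint continuity as soon as \<open>V\<close> is continuous at 0. This is how branches
  with merely continuous \<open>p\<close> and \<open>q\<close> are handled.\<close>

lemma C1_map_chain_const:
  fixes H :: "real \<Rightarrow> real^3 \<Rightarrow> real"
  assumes "C1_map (\<lambda>(\<epsilon>, v). H \<epsilon> v)" and H0: "\<And>v. H 0 v = c"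
  shows C1_map_param_deriv_continuous: "continuous_on UNIV (\<lambda>v. deriv (\<lambda>\<epsilon>. H \<epsilon> v) 0)"
    and C1_map_param_deriv_along: "isCont V 0 \<Longrightarrow>
      ((\<lambda>\<epsilon>. H \<epsilon> (V \<epsilon>)) has_real_derivative deriv (\<lambda>\<epsilon>. H \<epsilon> (V 0)) 0) (at 0)"
proof -
  obtain D :: "real \<times> (real^3) \<Rightarrow> (real \<times> (real^3)) \<Rightarrow>\<^sub>L real" where
    D: "\<And>v. ((\<lambda>(\<epsilon>, v). H \<epsilon> v) has_derivative blinfun_apply (D v)) (at v)"
    and cD: "continuous_on UNIV D"
    using assms(1) unfolding C1_map_def by blast
  define g where "g = (\<lambda>p. blinfun_apply (D p) (1, 0))"
  have cg: "continuous_on UNIV g"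
    unfolding g_def by (intro continuous_intros cD)
  have dH: "((\<lambda>\<epsilon>. H \<epsilon> v) has_real_derivative g (e, v)) (at e)" for e v
  proof -
    have "((\<lambda>\<epsilon>. (\<epsilon>, v)) has_derivative (\<lambda>h. (h, 0))) (at e)"
      by (auto intro!: derivative_eq_intros)
    from has_derivative_compose[OF this D]
    have "((\<lambda>\<epsilon>. H \<epsilon> v) has_derivative (\<lambda>h. blinfun_apply (D (e, v)) (h, 0))) (at e)" by simp
    moreover have "blinfun_apply (D (e, v)) (h, 0) = g (e, v) * h" for h
      using blinfun.scaleR_right[of "D (e, v)" h "(1, 0)"] by (simp add: g_def)
    ultimately show ?thesis by (simp add: has_field_derivative_def)
  qed
  then have dg: "deriv (\<lambda>\<epsilon>. H \<epsilon> v) 0 = g (0, v)" for v by (rule DERIV_imp_deriv)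
  show "continuous_on UNIV (\<lambda>v. deriv (\<lambda>\<epsilon>. H \<epsilon> v) 0)"
    unfolding dg by (rule continuous_on_compose2[OF cg]) (auto intro!: continuous_intros)
  assume V: "isCont V 0"
  have "\<exists>\<xi>. \<bar>\<xi>\<bar> \<le> \<bar>e\<bar> \<and> H e v - H 0 v = e * g (\<xi>, v)" for e v
  proof (cases e "0 :: real" rule: linorder_cases)
    case less
    from MVT2[OF less, of "\<lambda>\<epsilon>. H \<epsilon> v" "\<lambda>\<epsilon>. g (\<epsilon>, v)"] dH obtain \<xi> where
      "e < \<xi>" "\<xi> < 0" "H 0 v - H e v = (0 - e) * g (\<xi>, v)" by blast
    then show ?thesis by (intro exI[of _ \<xi>]) (auto simp: algebra_simps)
  next
    case greater
    from MVT2[OF greater, of "\<lambda>\<epsilon>. H \<epsilon> v" "\<lambda>\<epsilon>. g (\<epsilon>, v)"] dH obtain \<xi> where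
      "0 < \<xi>" "\<xi> < e" "H e v - H 0 v = (e - 0) * g (\<xi>, v)" by blast
    then show ?thesis by (intro exI[of _ \<xi>]) auto
  qed auto
  \<comment> \<open>The intermediate parameter is chosen as a function of \<open>e\<close> and
    \<open>v\<close>, so that \<open>v\<close> can be set to the moving point
    \<open>V e\<close>.\<close>
  then obtain \<xi> where \<xi>: "\<And>e v. \<bar>\<xi> e v\<bar> \<le> \<bar>e\<bar>" "\<And>e v. H e v - H 0 v = e * g (\<xi> e v, v)"
    by metis
  have "((\<lambda>e. \<xi> e (V e)) \<longlongrightarrow> 0) (at 0)"
    by (rule Lim_null_comparison[of _ "\<lambda>e. \<bar>e\<bar>"]) (use \<xi>(1) in \<open>auto intro!: tendsto_eq_intros\<close>)
  then have "((\<lambda>e. (\<xi> e (V e), V e)) \<longlongrightarrow> (0, V 0)) (at 0)"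
    using V by (intro tendsto_Pair) (simp_all add: isCont_def)
  moreover have "isCont g (0, V 0)" using cg by (simp add: continuous_on_eq_continuous_at)
  ultimately have "((\<lambda>e. g (\<xi> e (V e), V e)) \<longlongrightarrow> g (0, V 0)) (at 0)"
    by (rule isCont_tendsto_compose[rotated])
  moreover have "\<forall>\<^sub>F e in at 0. g (\<xi> e (V e), V e) = (H e (V e) - H 0 (V 0)) / (e - 0)"
    unfolding eventually_at_filter using \<xi>(2) by (simp add: H0)
  ultimately show "((\<lambda>\<epsilon>. H \<epsilon> (V \<epsilon>)) has_real_derivative deriv (\<lambda>\<epsilon>. H \<epsilon> (V 0)) 0) (at 0)"
    unfolding has_field_derivative_iff dg by (rule Lim_transform_eventually)
qed

section \<open>Functions of t alone\<close>

lemma C1_strip_radial: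
  fixes f :: "real \<Rightarrow> real"
  assumes "f C1_differentiable_on UNIV"
  shows "C1_strip UNIV (\<lambda>t \<theta>. f t)"
proof -
  have "continuous_on (UNIV \<times> UNIV) (\<lambda>p. f (fst p))"
    "continuous_on (UNIV \<times> UNIV) (\<lambda>p. vector_derivative f (at (fst p)))"
    using assms C1_differentiable_imp_continuous_on[OF assms] unfolding C1_differentiable_on_eq
    by (auto intro!: continuous_on_compose2[where f=fst and t=UNIV] continuous_intros)
  then show ?thesis
    using assms by (simp add: C1_strip_def C1_differentiable_on_eq Dt_def Dtheta_def case_prod_unfold)
qed

text \<open>Translates the one-variable regularity demanded in \<open>T_set\<close> into the
  regularity on the cylinder that the linearization uses.\<close>

lemma C2_cyl_radial:
  fixes f :: "real \<Rightarrow> real"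
  assumes "f C1_differentiable_on UNIV" "deriv f C1_differentiable_on UNIV"
  shows "C2_cyl UNIV (\<lambda>t \<theta>. f t)"
proof -
  have "Dt UNIV (\<lambda>t \<theta>. f t) = (\<lambda>t \<theta>. deriv f t)"
    by (simp add: Dt_def fun_eq_iff field_derivative_eq_vector_derivative)
  moreover have "Dtheta (\<lambda>t \<theta>. f t) = (\<lambda>t \<theta>. 0)"
    by (intro ext Dtheta_eqI) simp
  ultimately show ?thesis
    using C1_strip_radial[OF assms(1)] C1_strip_radial[OF assms(2)] C1_strip_radial[of "\<lambda>_. 0"]
    by (simp add: C2_cyl_def)
qed

section \<open>Real functions\<close>

lemma at_within_Icc_neq_bot:
  fixes t :: real
  assumes "T > 0" "t \<in> {-T..T}"
  shows "at t within {-T..T} \<noteq> bot"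
proof -
  have "t islimpt {-T..T}"
    by (rule connected_imp_perfect) (use assms in auto)
  then show ?thesis using trivial_limit_within by blast
qed

lemma connected_nonzero_same_sign:
  fixes f :: "'a::topological_space \<Rightarrow> real"
  assumes "continuous_on S f" "connected S" "\<And>v. v \<in> S \<Longrightarrow> f v \<noteq> 0" "u \<in> S" "v \<in> S"
  shows "f u * f v > 0"
proof -
  have "connected (f ` S)" using assms by (intro connected_continuous_image)
  moreover have "0 \<notin> f ` S" using assms(3) by force
  ultimately have "\<not> (f u \<le> 0 \<and> 0 \<le> f v)" if "u \<in> S" "v \<in> S" for u v
    using that unfolding connected_iff_interval by blast
  from this[OF assms(4,5)] this[OF assms(5,4)] show ?thesis
    unfolding zero_less_mult_iff by linarith
qed

text \<open>By evenness \<open>t\<close> may be replaced by its absolute value. A strict change of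
  sign between that point and \<open>s\<close> would force a zero strictly between 0 and
  \<open>T\<close>.\<close>

lemma even_same_sign_on_Icc:
  fixes w :: "real \<Rightarrow> real"
  assumes "continuous_on UNIV w" "\<And>t. w (-t) = w t" "w T = 0" "\<And>t. t \<in> {0<..<T} \<Longrightarrow> w t \<noteq> 0"
    "s \<in> {0<..<T}" "t \<in> {-T..T}"
  shows "w t * w s \<ge> 0"
proof (rule ccontr)
  assume neg: "\<not> w t * w s \<ge> 0"
  define r where "r = \<bar>t\<bar>"
  have r: "w r = w t" "0 \<le> r" "r \<le> T" using assms(2,6) by (auto simp: r_def abs_if)
  with neg assms(3) have "r \<noteq> T" by auto
  have s: "0 < s" "s < T" using assms(5) by auto
  \<comment> \<open>The point 0 lies in this interval only if \<open>r = 0\<close>; there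
    \<open>w\<close> is nonzero because \<open>w r * w s\<close> is assumed negative.\<close>
  have ne: "w v \<noteq> 0" if "v \<in> {min r s..max r s}" for v
  proof (cases "v = 0")
    case True
    then have "v = r" using that r s by (auto simp: min_def split: if_splits)
    then show ?thesis using neg r by auto
  next
    case False
    then show ?thesis using that r s \<open>r \<noteq> T\<close> by (intro assms(4)) auto
  qed
  have "w r * w s > 0"
    by (rule connected_nonzero_same_sign[of "{min r s..max r s}"])
       (use ne continuous_on_subset[OF assms(1)] in auto)
  then show False using neg r by simp
qed

section \<open>Mean curvature as a function of the 2-jet\<close>

unbundle cross3_syntax

lemma bounded_bilinear_cross3: "bounded_bilinear cross3"
  using bilinear_cross bilinear_conv_bounded_bilinear by blast

lemmas has_vector_derivative_cross3 =
  bounded_bilinear.has_vector_derivative[OF bounded_bilinear_cross3]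

lemma has_real_derivative_inner:
  assumes "(f has_vector_derivative f') (at t within S)" "(g has_vector_derivative g') (at t within S)"
  shows "((\<lambda>t. f t \<bullet> g t) has_real_derivative f t \<bullet> g' + f' \<bullet> g t) (at t within S)"
  using bounded_bilinear.has_vector_derivative[OF bounded_bilinear_inner assms]
  by (simp add: has_real_derivative_iff_has_vector_derivative)

text \<open>Mean curvature in terms of the unnormalized normal \<open>n\<close>: normalizing
  contributes one factor \<open>|n|\<close> to the denominator and \<open>EG - F^2\<close>
  contributes \<open>|n|^2\<close>. The resulting \<open>|n|^3\<close> is written through
  \<open>n \<bullet> n\<close>, which is convenient to differentiate.\<close>

definition mc_jet :: "real^3 \<Rightarrow> real^3 \<Rightarrow> real^3 \<Rightarrow> real^3 \<Rightarrow> real^3 \<Rightarrow> real" where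
  "mc_jet A B C D P =
     (let n = A \<times> B
      in ((A \<bullet> A) * (P \<bullet> n) - 2 * (A \<bullet> B) * (D \<bullet> n) + (B \<bullet> B) * (C \<bullet> n)) /
         (2 * (n \<bullet> n) * sqrt (n \<bullet> n)))"

text \<open>Lagrange's identity \<open>EG - F^2 = |n|^2\<close>. Where the normal field vanishes,
  both sides are quotients with denominator 0, hence 0.\<close>

lemma mean_curvature_eq_mc_jet:
  "mean_curvature I X t \<theta> =
     mc_jet (Dt I X t \<theta>) (Dtheta X t \<theta>) (Dt I (Dt I X) t \<theta>) (Dtheta (Dt I X) t \<theta>)
       (Dtheta (Dtheta X) t \<theta>)"
proof -
  define A B where "A = Dt I X t \<theta>" and "B = Dtheta X t \<theta>"
  define n where "n = A \<times> B"
  have W: "(A \<bullet> A) * (B \<bullet> B) - (A \<bullet> B)\<^sup>2 = n \<bullet> n"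
    using norm_cross_dot[of A B] by (simp add: n_def power_mult_distrib power2_norm_eq_inner)
  show ?thesis
    unfolding mean_curvature_def mc_jet_def unit_normal_def normal_field_def
      A_def[symmetric] B_def[symmetric] n_def[symmetric] Let_def power2_norm_eq_inner W
    unfolding norm_eq_sqrt_inner
    by (simp add: divide_simps)
qed

text \<open>The Delaunay surface has normal field \<open>x^2 N\<close> with \<open>N\<close> a unit
  vector, so there the squared length \<open>W\<close> is the fourth power of \<open>r = x\<close>.
  Its root is \<open>r^2\<close> for either sign of \<open>r\<close>, and the derivative becomes
  rational in \<open>r\<close>.\<close>

lemma DERIV_div_power_three_halves:
  fixes Q W :: "real \<Rightarrow> real"
  assumes "(Q has_real_derivative Q') (at s)" "(W has_real_derivative W') (at s)"
    and "W s = r ^ 4" "r \<noteq> 0"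
  shows "((\<lambda>s. Q s / (2 * W s * sqrt (W s))) has_real_derivative
           Q' / (2 * r ^ 6) - 3 * Q s * W' / (4 * r ^ 10)) (at s)"
proof -
  have sq: "sqrt (r ^ 4) = r\<^sup>2" 
    by (rule real_sqrt_unique) (simp_all flip: power_mult)
  have "W s > 0" using assms(3,4) by (simp add: zero_less_power_eq)
  then have "((\<lambda>s. sqrt (W s)) has_real_derivative inverse (sqrt (W s)) / 2 * W') (at s)"
    by (intro DERIV_chain2[OF DERIV_real_sqrt assms(2)])
  then have "((\<lambda>s. sqrt (W s)) has_real_derivative W' / (2 * r\<^sup>2)) (at s)"
    by (simp add: assms(3) sq field_simps)
  note DERIV_divide[OF assms(1) DERIV_mult[OF DERIV_cmult[OF assms(2), of 2] this]]
  moreover have "2 * W s * sqrt (W s) \<noteq> 0" using \<open>W s > 0\<close> by simp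
  ultimately have "((\<lambda>s. Q s / (2 * W s * sqrt (W s))) has_real_derivative
      (Q' * (2 * W s * sqrt (W s)) - Q s * (2 * W' * sqrt (W s) + W' / (2 * r\<^sup>2) * (2 * W s))) /
      (2 * W s * sqrt (W s) * (2 * W s * sqrt (W s)))) (at s)"
    by blast
  then show ?thesis
    unfolding assms(3) sq
    by (rule DERIV_cong) (use assms(4) in \<open>simp add: field_simps eval_nat_numeral\<close>)
qed

section \<open>The rotating orthonormal frame of cylindrical coordinates\<close>

definition e_rad :: "real \<Rightarrow> real^3" where
  "e_rad \<theta> = cos \<theta> *\<^sub>R axis 1 1 + sin \<theta> *\<^sub>R axis 2 1"

definition e_ang :: "real \<Rightarrow> real^3" where
  "e_ang \<theta> = cos \<theta> *\<^sub>R axis 2 1 - sin \<theta> *\<^sub>R axis 1 1"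

abbreviation e_ax :: "real^3" where
  "e_ax \<equiv> axis 3 1"

lemma e_rad_deriv: "(e_rad has_vector_derivative e_ang \<theta>) (at \<theta>)"
  unfolding e_rad_def e_ang_def by (auto intro!: derivative_eq_intros)

lemma e_ang_deriv: "(e_ang has_vector_derivative - e_rad \<theta>) (at \<theta>)"
  unfolding e_rad_def e_ang_def by (auto intro!: derivative_eq_intros)

lemma frame_inner:
  "e_rad \<theta> \<bullet> e_rad \<theta> = 1" "e_ang \<theta> \<bullet> e_ang \<theta> = 1" "e_ax \<bullet> e_ax = 1"
  "e_rad \<theta> \<bullet> e_ang \<theta> = 0" "e_ang \<theta> \<bullet> e_rad \<theta> = 0" "e_rad \<theta> \<bullet> e_ax = 0"
  "e_ax \<bullet> e_rad \<theta> = 0" "e_ang \<theta> \<bullet> e_ax = 0" "e_ax \<bullet> e_ang \<theta> = 0"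
  by (simp_all add: e_rad_def e_ang_def inner_axis_axis inner_simps flip: power2_eq_square)

lemma frame_cross:
  "e_rad \<theta> \<times> e_ang \<theta> = e_ax" "e_ang \<theta> \<times> e_ax = e_rad \<theta>" "e_ax \<times> e_rad \<theta> = e_ang \<theta>"
  "e_ang \<theta> \<times> e_rad \<theta> = - e_ax" "e_ax \<times> e_ang \<theta> = - e_rad \<theta>" "e_rad \<theta> \<times> e_ax = - e_ang \<theta>"
proof -
  have 1: "e_rad \<theta> \<times> e_ang \<theta> = ((cos \<theta>)\<^sup>2 + (sin \<theta>)\<^sup>2) *\<^sub>R e_ax"
    by (simp add: e_rad_def e_ang_def cross_basis cross_add_left cross_mult_left cross_mult_right
      Cross3.right_diff_distrib power2_eq_square flip: scaleR_left_distrib)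
  then show 1: "e_rad \<theta> \<times> e_ang \<theta> = e_ax" by simp
  show 2: "e_ang \<theta> \<times> e_ax = e_rad \<theta>" "e_ax \<times> e_rad \<theta> = e_ang \<theta>"
    by (simp_all add: e_rad_def e_ang_def cross_basis cross_add_right cross_mult_left cross_mult_right
      Cross3.left_diff_distrib)
  show "e_ang \<theta> \<times> e_rad \<theta> = - e_ax" "e_ax \<times> e_ang \<theta> = - e_rad \<theta>" "e_rad \<theta> \<times> e_ax = - e_ang \<theta>"
    using 1 2 by (simp_all add: cross_skew[of "e_ang \<theta>" "e_rad \<theta>"] cross_skew[of e_ax "e_ang \<theta>"]
      cross_skew[of "e_rad \<theta>" e_ax])
qed

lemma delaunay_surface_frame:
  "delaunay_surface x z t \<theta> = x t *\<^sub>R e_rad \<theta> + z t *\<^sub>R e_ax"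
  by (simp add: delaunay_surface_def e_rad_def vec_eq_iff forall_3 axis_def)

section \<open>Delaunay surfaces\<close>

locale delaunay =
  fixes a :: real and x z :: "real \<Rightarrow> real"
  assumes a_range: "a \<in> {-1<..<0} \<union> {0<..}" and profile: "delaunay_profile a x z"
begin

section \<open>The profile curve and its first integral\<close>

abbreviation "\<gamma> \<equiv> delaunay_gamma a"
abbreviation "x' \<equiv> deriv x"

lemma gamma_nz: "\<gamma> \<noteq> 0"
  using a_range by (auto simp: delaunay_gamma_def)

lemma x_deriv: "(x has_real_derivative x' t) (at t within S)"
  and x'_deriv: "(x' has_real_derivative (1 + 2 * \<gamma>) * x t - 2 * (x t) ^ 3) (at t within S)"
  and z_deriv: "(z has_real_derivative (x t)\<^sup>2 - \<gamma>) (at t within S)"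
  using profile unfolding delaunay_profile_def by (auto intro: DERIV_subset)

lemmas prof_deriv [derivative_intros] =
  DERIV_chain2[OF x_deriv] DERIV_chain2[OF x'_deriv] DERIV_chain2[OF z_deriv]

text \<open>The equation for \<open>x\<close> makes the difference of the two sides constant. At 0
  it vanishes because \<open>(1 + a)^2 - a (1 + a) = 1 + a\<close>. Geometrically, the
  parametrization is conformal: both tangent vectors have length \<open>|x|\<close>.\<close>

lemma first_integral: "(x' t)\<^sup>2 + ((x t)\<^sup>2 - \<gamma>)\<^sup>2 = (x t)\<^sup>2"
proof -
  let ?E = "\<lambda>t. (x' t)\<^sup>2 + ((x t)\<^sup>2 - \<gamma>)\<^sup>2 - (x t)\<^sup>2"
  have "(?E has_real_derivative 0) (at t)" for t
    by (auto intro!: derivative_eq_intros simp: power2_eq_square power3_eq_cube) algebra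
  then have "?E t = ?E 0"
    by (rule DERIV_isconst_all[rule_format]) 
  moreover have "?E 0 = 0"
    using profile by (simp add: delaunay_profile_def delaunay_gamma_def power2_eq_square algebra_simps)
  ultimately show ?thesis by simp
qed

lemma x_nz: "x t \<noteq> 0"
proof
  assume "x t = 0"
  then have "(x' t)\<^sup>2 + \<gamma>\<^sup>2 = 0" using first_integral[of t] by simp
  then show False using gamma_nz by (simp add: sum_power2_eq_zero_iff)
qed

text \<open>\<open>k\<close> and \<open>l\<close> are the principal curvatures, so the potential of the Jacobi operator is
  \<open>2 p\<^sub>a = x\<^sup>2 (k\<^sup>2 + l\<^sup>2)\<close>.\<close>

definition "k t = 1 + \<gamma> / (x t)\<^sup>2"
definition "l t = 1 - \<gamma> / (x t)\<^sup>2"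
definition "\<mu> t = x' t / x t"
definition "Xt t \<theta> = x' t *\<^sub>R e_rad \<theta> + ((x t)\<^sup>2 - \<gamma>) *\<^sub>R e_ax"
definition "Xh t \<theta> = x t *\<^sub>R e_ang \<theta>"
definition "N t \<theta> = (- x t * l t) *\<^sub>R e_rad \<theta> + \<mu> t *\<^sub>R e_ax"

section \<open>Principal curvatures and the moving frame of the surface\<close>

lemma k_deriv: "(k has_real_derivative - 2 * \<gamma> * \<mu> t / (x t)\<^sup>2) (at t within S)"
  and l_deriv: "(l has_real_derivative 2 * \<gamma> * \<mu> t / (x t)\<^sup>2) (at t within S)"
  unfolding k_def[abs_def] l_def[abs_def] \<mu>_def using x_nz
  by (auto intro!: derivative_eq_intros simp: field_simps power2_eq_square)

text \<open>Gauss's equation for the conformal factor \<open>x^2\<close>: the second derivative of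
  \<open>log |x|\<close> is \<open>- x^2\<close> times the Gauss curvature
  \<open>k l\<close>.\<close>

lemma \<mu>_deriv: "(\<mu> has_real_derivative - (x t)\<^sup>2 * k t * l t) (at t within S)"
proof -
  have "x' t * x' t = (x t)\<^sup>2 - ((x t)\<^sup>2 - \<gamma>)\<^sup>2"
    using first_integral[of t] by (simp add: power2_eq_square)
  then show ?thesis
    unfolding k_def l_def \<mu>_def[abs_def] using x_nz
    by (auto intro!: derivative_eq_intros simp: divide_simps)
       (simp add: eval_nat_numeral algebra_simps)
qed

text \<open>The first integral divided by \<open>x^2\<close>; it makes \<open>N\<close> a unit
  vector.\<close>

lemma \<mu>_sq: "\<mu> t * \<mu> t = 1 - (x t)\<^sup>2 * (l t)\<^sup>2"
proof -
  have "x' t * x' t = (x t)\<^sup>2 - ((x t)\<^sup>2 - \<gamma>)\<^sup>2"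
    using first_integral[of t] by (simp add: power2_eq_square)
  then show ?thesis unfolding \<mu>_def l_def using x_nz by (simp add: divide_simps) (simp add: eval_nat_numeral algebra_simps)
qed

text \<open>The last identity expresses that the mean curvature \<open>(k + l) / 2\<close> is
  1.\<close>

lemma frame_coeffs: "x' t = \<mu> t * x t" "(x t)\<^sup>2 - \<gamma> = (x t)\<^sup>2 * l t" "k t = 2 - l t"
  using x_nz by (simp_all add: \<mu>_def l_def k_def field_simps)

lemma Xt_alt: "Xt t \<theta> = (\<mu> t * x t) *\<^sub>R e_rad \<theta> + ((x t)\<^sup>2 * l t) *\<^sub>R e_ax"
  unfolding Xt_def frame_coeffs(1,2) ..

lemma surf_inner:
  "Xt t \<theta> \<bullet> Xt t \<theta> = (x t)\<^sup>2" "Xh t \<theta> \<bullet> Xh t \<theta> = (x t)\<^sup>2" "N t \<theta> \<bullet> N t \<theta> = 1"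
  "Xt t \<theta> \<bullet> Xh t \<theta> = 0" "Xh t \<theta> \<bullet> Xt t \<theta> = 0" "Xt t \<theta> \<bullet> N t \<theta> = 0"
  "N t \<theta> \<bullet> Xt t \<theta> = 0" "Xh t \<theta> \<bullet> N t \<theta> = 0" "N t \<theta> \<bullet> Xh t \<theta> = 0"
  using \<mu>_sq[of t] 
  by (simp_all add: Xt_alt Xh_def N_def inner_simps frame_inner power2_eq_square) algebra+

lemma surf_cross:
  "Xt t \<theta> \<times> Xh t \<theta> = (x t)\<^sup>2 *\<^sub>R N t \<theta>"
  "Xh t \<theta> \<times> N t \<theta> = Xt t \<theta>"
  "N t \<theta> \<times> Xh t \<theta> = - Xt t \<theta>"
  "Xt t \<theta> \<times> N t \<theta> = - Xh t \<theta>"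
proof -
  show "Xt t \<theta> \<times> Xh t \<theta> = (x t)\<^sup>2 *\<^sub>R N t \<theta>"
    by (simp add: Xt_alt Xh_def N_def cross_add_left cross_add_right cross_mult_left
      cross_mult_right Cross3.left_diff_distrib Cross3.right_diff_distrib frame_cross algebra_simps power2_eq_square)
  show 1: "Xh t \<theta> \<times> N t \<theta> = Xt t \<theta>"
    by (simp add: Xt_alt Xh_def N_def cross_add_left cross_add_right cross_mult_left
      cross_mult_right Cross3.left_diff_distrib Cross3.right_diff_distrib frame_cross algebra_simps power2_eq_square)
  show "N t \<theta> \<times> Xh t \<theta> = - Xt t \<theta>"
    using 1 cross_skew by metis
  have "Xt t \<theta> \<times> N t \<theta> = - ((\<mu> t * \<mu> t + (x t)\<^sup>2 * (l t)\<^sup>2) * x t) *\<^sub>R e_ang \<theta>"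
    by (simp add: Xt_alt Xh_def N_def cross_add_left cross_add_right cross_mult_left
      cross_mult_right Cross3.left_diff_distrib Cross3.right_diff_distrib frame_cross algebra_simps power2_eq_square)
  then show "Xt t \<theta> \<times> N t \<theta> = - Xh t \<theta>"
    by (simp add: \<mu>_sq Xh_def)
qed

text \<open>Gauss and Weingarten formulas of the Delaunay surface. The derivatives of
  \<open>N\<close> identify \<open>k\<close> and \<open>l\<close> as principal curvatures along
  meridians and parallels; all derivatives stay in the frame \<open>Xt\<close>, \<open>Xh\<close>,
  \<open>N\<close>.\<close>

lemma surf_derivs:
  "((\<lambda>s. delaunay_surface x z s \<theta>) has_vector_derivative Xt t \<theta>) (at t within S)"
  "((\<lambda>s. delaunay_surface x z t s) has_vector_derivative Xh t \<theta>) (at \<theta>)"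
  "((\<lambda>s. N s \<theta>) has_vector_derivative - k t *\<^sub>R Xt t \<theta>) (at t within S)"
  "((\<lambda>s. N t s) has_vector_derivative - l t *\<^sub>R Xh t \<theta>) (at \<theta>)"
  "((\<lambda>s. Xt s \<theta>) has_vector_derivative \<mu> t *\<^sub>R Xt t \<theta> + (k t * (x t)\<^sup>2) *\<^sub>R N t \<theta>) (at t within S)"
  "((\<lambda>s. Xt t s) has_vector_derivative \<mu> t *\<^sub>R Xh t \<theta>) (at \<theta>)"
  "((\<lambda>s. Xh t s) has_vector_derivative - \<mu> t *\<^sub>R Xt t \<theta> + (l t * (x t)\<^sup>2) *\<^sub>R N t \<theta>) (at \<theta>)"
proof -
  show "((\<lambda>s. delaunay_surface x z s \<theta>) has_vector_derivative Xt t \<theta>) (at t within S)"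
    unfolding delaunay_surface_frame Xt_def
    by (auto intro!: derivative_eq_intros x_deriv z_deriv)
  show "((\<lambda>s. delaunay_surface x z t s) has_vector_derivative Xh t \<theta>) (at \<theta>)"
    unfolding delaunay_surface_frame Xh_def
    by (auto intro!: derivative_eq_intros e_rad_deriv)
  \<comment> \<open>Minus the radial component of the t-derivative of \<open>N\<close>, computed by
    the product rule for \<open>x l\<close>.\<close>
  have 1: "x' t * l t + x t * (2 * \<gamma> * \<mu> t / (x t)\<^sup>2) = k t * (\<mu> t * x t)"
    using x_nz by (simp add: frame_coeffs k_def l_def field_simps power2_eq_square)
  show "((\<lambda>s. N s \<theta>) has_vector_derivative - k t *\<^sub>R Xt t \<theta>) (at t within S)"
    unfolding N_def Xt_alt
    apply (rule derivative_eq_intros x_deriv l_deriv \<mu>_deriv refl)+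
    using 1 by (simp add: algebra_simps flip: scaleR_left_distrib)
  show "((\<lambda>s. N t s) has_vector_derivative - l t *\<^sub>R Xh t \<theta>) (at \<theta>)"
    unfolding N_def Xh_def
    by (auto intro!: derivative_eq_intros e_rad_deriv)
  \<comment> \<open>The radial component of the second t-derivative of the surface, split along
    \<open>Xt\<close> and \<open>N\<close>.\<close>
  have 2: "(1 + 2 * \<gamma>) * x t - 2 * (x t) ^ 3 = \<mu> t * (\<mu> t * x t) + k t * (x t)\<^sup>2 * (- x t * l t)"
    unfolding mult.assoc[symmetric] \<mu>_sq
    using x_nz by (simp add: k_def l_def field_simps power2_eq_square power3_eq_cube)
  show "((\<lambda>s. Xt s \<theta>) has_vector_derivative \<mu> t *\<^sub>R Xt t \<theta> + (k t * (x t)\<^sup>2) *\<^sub>R N t \<theta>) (at t within S)"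
    unfolding Xt_def
    apply (rule derivative_eq_intros x_deriv x'_deriv refl)+
    unfolding frame_coeffs(2) Xt_def[symmetric]
    unfolding Xt_alt N_def
    apply (simp add: 2 frame_coeffs(1))
    apply (simp add: frame_coeffs(3) algebra_simps power2_eq_square)
    done
  show "((\<lambda>s. Xt t s) has_vector_derivative \<mu> t *\<^sub>R Xh t \<theta>) (at \<theta>)"
    unfolding Xt_alt Xh_def
    by (auto intro!: derivative_eq_intros e_rad_deriv simp: mult.commute)
  \<comment> \<open>The identity \<open>\<mu>^2 + x^2 l^2 = 1\<close>, used to resolve the radial
    vector \<open>- x e_rad\<close> into its \<open>Xt\<close> and \<open>N\<close> parts.\<close>
  have 4: "x t = \<mu> t * \<mu> t * x t + (x t)\<^sup>2 * (l t)\<^sup>2 * x t"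
    unfolding \<mu>_sq by (simp add: algebra_simps)
  show "((\<lambda>s. Xh t s) has_vector_derivative - \<mu> t *\<^sub>R Xt t \<theta> + (l t * (x t)\<^sup>2) *\<^sub>R N t \<theta>) (at \<theta>)"
    unfolding Xt_alt Xh_def N_def
    apply (rule derivative_eq_intros e_ang_deriv refl)+
    using 4 by (simp add: algebra_simps power2_eq_square flip: scaleR_left_distrib)
qed

lemma delaunay_normal_eq: "delaunay_normal x z = N"
proof (intro ext)
  fix t \<theta>
  have "normal_field UNIV (delaunay_surface x z) t \<theta> = (x t)\<^sup>2 *\<^sub>R N t \<theta>"
    by (simp add: normal_field_def Dt_eqI[OF surf_derivs(1)] Dtheta_eqI[OF surf_derivs(2)]
      surf_cross)
  moreover have "norm (N t \<theta>) = 1" by (simp add: norm_eq_sqrt_inner surf_inner)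
  ultimately show "delaunay_normal x z t \<theta> = N t \<theta>"
    using x_nz by (simp add: delaunay_normal_def unit_normal_def)
qed

text \<open>The surface \<open>X + \<phi> N\<close> has 2-jet of this shape, with \<open>c = - k'(t)\<close>, whose value does not
  enter the derivative because the corresponding term of \<open>X\<^sub>t\<^sub>t\<close> is tangential.\<close>

lemma mc_jet_linearization:
  fixes f ft fh ftt fth fhh :: "real \<Rightarrow> real"
  assumes d: "(f has_real_derivative u) (at 0)" "(ft has_real_derivative ut) (at 0)"
    "(fh has_real_derivative uh) (at 0)" "(ftt has_real_derivative utt) (at 0)"
    "(fth has_real_derivative uth) (at 0)" "(fhh has_real_derivative uhh) (at 0)"
    and z: "f 0 = 0" "ft 0 = 0" "fh 0 = 0" "ftt 0 = 0" "fth 0 = 0" "fhh 0 = 0"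
  shows "((\<lambda>s. mc_jet
      ((1 - f s * k t) *\<^sub>R Xt t \<theta> + ft s *\<^sub>R N t \<theta>)
      ((1 - f s * l t) *\<^sub>R Xh t \<theta> + fh s *\<^sub>R N t \<theta>)
      ((1 - f s * k t) *\<^sub>R (\<mu> t *\<^sub>R Xt t \<theta> + (k t * (x t)\<^sup>2) *\<^sub>R N t \<theta>)
         + (f s * c - 2 * ft s * k t) *\<^sub>R Xt t \<theta> + ftt s *\<^sub>R N t \<theta>)
      (((1 - f s * k t) * \<mu> t - ft s * l t) *\<^sub>R Xh t \<theta> - (fh s * k t) *\<^sub>R Xt t \<theta> + fth s *\<^sub>R N t \<theta>)
      ((1 - f s * l t) *\<^sub>R (- \<mu> t *\<^sub>R Xt t \<theta> + (l t * (x t)\<^sup>2) *\<^sub>R N t \<theta>)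
         - (2 * fh s * l t) *\<^sub>R Xh t \<theta> + fhh s *\<^sub>R N t \<theta>))
    has_real_derivative (utt + uhh) / (2 * (x t)\<^sup>2) + u * ((k t)\<^sup>2 + (l t)\<^sup>2) / 2) (at 0)"
    (is "((\<lambda>s. mc_jet (?A s) (?B s) (?C s) (?D s) (?P s)) has_real_derivative _) _")
proof -
  let ?A' = "(- u * k t) *\<^sub>R Xt t \<theta> + ut *\<^sub>R N t \<theta>"
  let ?B' = "(- u * l t) *\<^sub>R Xh t \<theta> + uh *\<^sub>R N t \<theta>"
  let ?C' = "(- u * k t) *\<^sub>R (\<mu> t *\<^sub>R Xt t \<theta> + (k t * (x t)\<^sup>2) *\<^sub>R N t \<theta>)
         + (u * c - 2 * ut * k t) *\<^sub>R Xt t \<theta> + utt *\<^sub>R N t \<theta>"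
  let ?D' = "(- u * k t * \<mu> t - ut * l t) *\<^sub>R Xh t \<theta> - (uh * k t) *\<^sub>R Xt t \<theta> + uth *\<^sub>R N t \<theta>"
  let ?P' = "(- u * l t) *\<^sub>R (- \<mu> t *\<^sub>R Xt t \<theta> + (l t * (x t)\<^sup>2) *\<^sub>R N t \<theta>)
         - (2 * uh * l t) *\<^sub>R Xh t \<theta> + uhh *\<^sub>R N t \<theta>"
  let ?n = "\<lambda>s. ?A s \<times> ?B s"
  \<comment> \<open>The product rule gives the normal component \<open>- u (k + l) x^2\<close>, and
    \<open>k + l = 2\<close>.\<close>
  let ?n' = "- (2 * u * (x t)\<^sup>2) *\<^sub>R N t \<theta> - ut *\<^sub>R Xt t \<theta> - uh *\<^sub>R Xh t \<theta>"
  have A: "(?A has_vector_derivative ?A') (at 0)"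
    by (rule derivative_eq_intros d refl)+ simp
  have B: "(?B has_vector_derivative ?B') (at 0)"
    by (rule derivative_eq_intros d refl)+ simp
  have C: "(?C has_vector_derivative ?C') (at 0)"
    by (rule derivative_eq_intros d refl)+ simp
  have D: "(?D has_vector_derivative ?D') (at 0)"
    by (rule derivative_eq_intros d refl)+ simp
  have P: "(?P has_vector_derivative ?P') (at 0)"
    by (rule derivative_eq_intros d refl)+ simp
  have n: "(?n has_vector_derivative ?n') (at 0)"
  proof -
    have "?A 0 \<times> ?B' + ?A' \<times> ?B 0 = ?n'"
      unfolding frame_coeffs(3)
      by (simp add: z cross_add_left cross_add_right cross_mult_left cross_mult_right
          Cross3.left_diff_distrib Cross3.right_diff_distrib surf_cross algebra_simps
          flip: scaleR_left_distrib)
    then show ?thesis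
      using has_vector_derivative_cross3[OF A B] by simp
  qed
  have n0: "?n 0 = (x t)\<^sup>2 *\<^sub>R N t \<theta>"
    by (simp add: z surf_cross)
  let ?W = "\<lambda>s. ?n s \<bullet> ?n s"
  let ?Q = "\<lambda>s. (?A s \<bullet> ?A s) * (?P s \<bullet> ?n s) - 2 * (?A s \<bullet> ?B s) * (?D s \<bullet> ?n s)
                 + (?B s \<bullet> ?B s) * (?C s \<bullet> ?n s)"
  note ip = has_real_derivative_inner
  have zero: "?A 0 = Xt t \<theta>" "?B 0 = Xh t \<theta>" "?D 0 = \<mu> t *\<^sub>R Xh t \<theta>"
    "?C 0 = \<mu> t *\<^sub>R Xt t \<theta> + (k t * (x t)\<^sup>2) *\<^sub>R N t \<theta>"
    "?P 0 = - \<mu> t *\<^sub>R Xt t \<theta> + (l t * (x t)\<^sup>2) *\<^sub>R N t \<theta>"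
    by (simp_all add: z)
  note inner_eval = inner_simps surf_inner power2_eq_square
  have AA: "((\<lambda>s. ?A s \<bullet> ?A s) has_real_derivative - 2 * u * k t * (x t)\<^sup>2) (at 0)"
    by (rule DERIV_cong[OF ip[OF A A]], unfold zero) (simp add: inner_eval)
  \<comment> \<open>The parametrization stays orthogonal to first order, so the term with the mixed
    derivative contributes nothing to the derivative of \<open>?Q\<close>.\<close>
  have AB: "((\<lambda>s. ?A s \<bullet> ?B s) has_real_derivative 0) (at 0)"
    by (rule DERIV_cong[OF ip[OF A B]], unfold zero) (simp add: inner_eval)
  have BB: "((\<lambda>s. ?B s \<bullet> ?B s) has_real_derivative - 2 * u * l t * (x t)\<^sup>2) (at 0)"
    by (rule DERIV_cong[OF ip[OF B B]], unfold zero) (simp add: inner_eval)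
  have Cn: "((\<lambda>s. ?C s \<bullet> ?n s) has_real_derivative
      utt * (x t)\<^sup>2 - ut * \<mu> t * (x t)\<^sup>2 - u * (2 * k t + (k t)\<^sup>2) * ((x t)\<^sup>2 * (x t)\<^sup>2)) (at 0)"
    by (rule DERIV_cong[OF ip[OF C n]], unfold n0, unfold zero) (simp add: inner_eval, simp add: algebra_simps)
  have Pn: "((\<lambda>s. ?P s \<bullet> ?n s) has_real_derivative
      uhh * (x t)\<^sup>2 + ut * \<mu> t * (x t)\<^sup>2 - u * (2 * l t + (l t)\<^sup>2) * ((x t)\<^sup>2 * (x t)\<^sup>2)) (at 0)"
    by (rule DERIV_cong[OF ip[OF P n]], unfold n0, unfold zero) (simp add: inner_eval, simp add: algebra_simps)
  have zero': "?A 0 \<bullet> ?A 0 = (x t)\<^sup>2" "?A 0 \<bullet> ?B 0 = 0" "?B 0 \<bullet> ?B 0 = (x t)\<^sup>2" "?D 0 \<bullet> ?n 0 = 0"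
    "?C 0 \<bullet> ?n 0 = k t * ((x t)\<^sup>2 * (x t)\<^sup>2)" "?P 0 \<bullet> ?n 0 = l t * ((x t)\<^sup>2 * (x t)\<^sup>2)"
    unfolding n0 unfolding zero by (simp_all add: inner_eval)
  have dW: "(?W has_real_derivative - 4 * u * x t ^ 4) (at 0)"
    by (rule DERIV_cong[OF ip[OF n n]], unfold n0) (simp add: inner_eval eval_nat_numeral)
  \<comment> \<open>The terms with \<open>ut\<close> cancel. The factor of \<open>- u x^6\<close>
    arises as \<open>4 k l + 2 (k + l) + k^2 + l^2\<close>, which is \<open>12 - (k^2 + l^2)\<close>
    because \<open>k + l = 2\<close>.\<close>
  have dQ: "(?Q has_real_derivative
     x t ^ 4 * (utt + uhh) - u * x t ^ 6 * (12 - ((k t)\<^sup>2 + (l t)\<^sup>2))) (at 0)"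
    by (rule DERIV_cong[OF DERIV_add[OF DERIV_diff[OF DERIV_mult[OF AA Pn]
      DERIV_mult[OF DERIV_cmult[OF AB, of 2] ip[OF D n]]] DERIV_mult[OF BB Cn]]], unfold zero')
      (simp add: frame_coeffs(3), simp add: algebra_simps eval_nat_numeral)
  have W0: "?W 0 = x t ^ 4"
    by (simp add: n0 surf_inner eval_nat_numeral)
  have Q0: "?Q 0 = 2 * x t ^ 6"
    unfolding zero' by (simp add: frame_coeffs(3) algebra_simps eval_nat_numeral)
  \<comment> \<open>The numerator contributes \<open>- 6 u\<close> and the denominator
    \<open>+ 6 u\<close>; after they cancel, the Jacobi operator remains.\<close>
  have alg: "(r ^ 4 * S - u * r ^ 6 * (12 - K)) / (2 * r ^ 6)
      - 3 * (2 * r ^ 6) * (- 4 * u * r ^ 4) / (4 * r ^ 10) = S / (2 * r\<^sup>2) + u * K / 2"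
    if "r \<noteq> 0" for r S K :: real
    using that by (simp add: field_simps eval_nat_numeral)
  have "((\<lambda>s. ?Q s / (2 * ?W s * sqrt (?W s))) has_real_derivative
      (utt + uhh) / (2 * (x t)\<^sup>2) + u * ((k t)\<^sup>2 + (l t)\<^sup>2) / 2) (at 0)"
    using DERIV_div_power_three_halves[where Q = ?Q and W = ?W and s = 0 and r = "x t", OF dQ dW W0 x_nz]
    unfolding Q0 alg[OF x_nz] .
  then show ?thesis
    by (simp add: mc_jet_def Let_def)
qed

text \<open>The translation has zero derivatives, and \<open>surf_derivs\<close> expresses the rest
  in the frame \<open>Xt\<close>, \<open>Xh\<close>, \<open>N\<close>. The result is brought to the
  shape differentiated in \<open>mc_jet_linearization\<close>.\<close>

lemma perturbed_jets:
  fixes p q :: real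
  assumes I: "\<forall>t\<in>I. at t within I \<noteq> bot" and \<phi>: "C2_cyl I \<phi>" and t: "t \<in> I"
  defines "Y \<equiv> perturbed_surface x z p q \<phi>"
  shows "Dt I Y t \<theta> = (1 - \<phi> t \<theta> * k t) *\<^sub>R Xt t \<theta> + Dt I \<phi> t \<theta> *\<^sub>R N t \<theta>" (is "_ = ?Yt t \<theta>")
    "Dtheta Y t \<theta> = (1 - \<phi> t \<theta> * l t) *\<^sub>R Xh t \<theta> + Dtheta \<phi> t \<theta> *\<^sub>R N t \<theta>" (is "_ = ?Yh t \<theta>")
    "Dt I (Dt I Y) t \<theta> = (1 - \<phi> t \<theta> * k t) *\<^sub>R (\<mu> t *\<^sub>R Xt t \<theta> + (k t * (x t)\<^sup>2) *\<^sub>R N t \<theta>)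
         + (\<phi> t \<theta> * (2 * \<gamma> * \<mu> t / (x t)\<^sup>2) - 2 * Dt I \<phi> t \<theta> * k t) *\<^sub>R Xt t \<theta> + Dt I (Dt I \<phi>) t \<theta> *\<^sub>R N t \<theta>"
    "Dtheta (Dt I Y) t \<theta> = ((1 - \<phi> t \<theta> * k t) * \<mu> t - Dt I \<phi> t \<theta> * l t) *\<^sub>R Xh t \<theta>
         - (Dtheta \<phi> t \<theta> * k t) *\<^sub>R Xt t \<theta> + Dtheta (Dt I \<phi>) t \<theta> *\<^sub>R N t \<theta>"
    "Dtheta (Dtheta Y) t \<theta> = (1 - \<phi> t \<theta> * l t) *\<^sub>R (- \<mu> t *\<^sub>R Xt t \<theta> + (l t * (x t)\<^sup>2) *\<^sub>R N t \<theta>)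
         - (2 * Dtheta \<phi> t \<theta> * l t) *\<^sub>R Xh t \<theta> + Dtheta (Dtheta \<phi>) t \<theta> *\<^sub>R N t \<theta>"
proof -
  note \<phi>d = C2_cyl_derivs[OF \<phi>]
  note \<phi>r = \<phi>d[folded has_real_derivative_iff_has_vector_derivative]
  \<comment> \<open>Established on the whole strip, because the formula itself is differentiated
    again below.\<close>
  have Yt: "Dt I Y t \<theta> = ?Yt t \<theta>" if "t \<in> I" for t \<theta>
    apply (rule Dt_eqI[OF _ bspec[OF I that]])
    unfolding Y_def perturbed_surface_def delaunay_normal_eq
    apply (rule derivative_eq_intros surf_derivs \<phi>r that refl)+
    by (simp add: algebra_simps)
  have Yh: "Dtheta Y t \<theta> = ?Yh t \<theta>" if "t \<in> I" for t \<theta>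
    apply (rule Dtheta_eqI)
    unfolding Y_def perturbed_surface_def delaunay_normal_eq
    apply (rule derivative_eq_intros surf_derivs \<phi>r that refl)+
    by (simp add: algebra_simps)
  show "Dt I Y t \<theta> = ?Yt t \<theta>" "Dtheta Y t \<theta> = ?Yh t \<theta>" using Yt Yh t by auto
  have "Dt I (Dt I Y) t \<theta> = Dt I ?Yt t \<theta>" by (rule Dt_cong[OF _ t]) (rule Yt)
  also have "\<dots> = (1 - \<phi> t \<theta> * k t) *\<^sub>R (\<mu> t *\<^sub>R Xt t \<theta> + (k t * (x t)\<^sup>2) *\<^sub>R N t \<theta>)
         + (\<phi> t \<theta> * (2 * \<gamma> * \<mu> t / (x t)\<^sup>2) - 2 * Dt I \<phi> t \<theta> * k t) *\<^sub>R Xt t \<theta> + Dt I (Dt I \<phi>) t \<theta> *\<^sub>R N t \<theta>"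
    apply (rule Dt_eqI[OF _ bspec[OF I t]])
    apply (rule derivative_eq_intros surf_derivs k_deriv \<phi>r t refl)+
    by (simp add: vec_eq_iff algebra_simps)
  finally show "Dt I (Dt I Y) t \<theta> = \<dots>" .
  have "Dtheta (Dt I Y) t \<theta> = Dtheta ?Yt t \<theta>" by (rule Dtheta_cong) (rule Yt[OF t])
  also have "\<dots> = ((1 - \<phi> t \<theta> * k t) * \<mu> t - Dt I \<phi> t \<theta> * l t) *\<^sub>R Xh t \<theta>
         - (Dtheta \<phi> t \<theta> * k t) *\<^sub>R Xt t \<theta> + Dtheta (Dt I \<phi>) t \<theta> *\<^sub>R N t \<theta>"
    apply (rule Dtheta_eqI)
    apply (rule derivative_eq_intros surf_derivs \<phi>r t refl)+
    by (simp add: vec_eq_iff algebra_simps)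
  finally show "Dtheta (Dt I Y) t \<theta> = \<dots>" .
  have "Dtheta (Dtheta Y) t \<theta> = Dtheta ?Yh t \<theta>" by (rule Dtheta_cong) (rule Yh[OF t])
  also have "\<dots> = (1 - \<phi> t \<theta> * l t) *\<^sub>R (- \<mu> t *\<^sub>R Xt t \<theta> + (l t * (x t)\<^sup>2) *\<^sub>R N t \<theta>)
         - (2 * Dtheta \<phi> t \<theta> * l t) *\<^sub>R Xh t \<theta> + Dtheta (Dtheta \<phi>) t \<theta> *\<^sub>R N t \<theta>"
    apply (rule Dtheta_eqI)
    apply (rule derivative_eq_intros surf_derivs \<phi>r t refl)+
    by (simp add: vec_eq_iff algebra_simps)
  finally show "Dtheta (Dtheta Y) t \<theta> = \<dots>" .
qed

end

unbundle no cross3_syntax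

section \<open>Linearization and solvability\<close>

context delaunay begin

text \<open>The family starts at 0, so all its jets vanish at \<open>s = 0\<close> and
  \<open>mc_jet_linearization\<close> applies. The translations \<open>p s\<close> and
  \<open>q s\<close> may vary arbitrarily with \<open>s\<close>, since mean curvature depends only
  on derivatives of the surface.\<close>

lemma mean_curvature_linearization:
  assumes I: "\<forall>t\<in>I. at t within I \<noteq> bot" and t: "t \<in> I"
    and \<Phi>: "\<forall>\<^sub>F s in nhds 0. C2_cyl I (\<Phi> s)"
    and zero: "\<And>t \<theta>. t \<in> I \<Longrightarrow> \<Phi> 0 t \<theta> = 0"
    and d: "((\<lambda>s. \<Phi> s t \<theta>) has_real_derivative u) (at 0)"
    "((\<lambda>s. Dt I (\<Phi> s) t \<theta>) has_real_derivative ut) (at 0)"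
    "((\<lambda>s. Dtheta (\<Phi> s) t \<theta>) has_real_derivative uh) (at 0)"
    "((\<lambda>s. Dt I (Dt I (\<Phi> s)) t \<theta>) has_real_derivative utt) (at 0)"
    "((\<lambda>s. Dtheta (Dt I (\<Phi> s)) t \<theta>) has_real_derivative uth) (at 0)"
    "((\<lambda>s. Dtheta (Dtheta (\<Phi> s)) t \<theta>) has_real_derivative uhh) (at 0)"
  shows "((\<lambda>s. mean_curvature I (perturbed_surface x z (p s) (q s) (\<Phi> s)) t \<theta>)
    has_real_derivative (utt + uhh) / (2 * (x t)\<^sup>2) + u * ((k t)\<^sup>2 + (l t)\<^sup>2) / 2) (at 0)"
proof -
  have 1: "Dt I (\<Phi> 0) t \<theta> = 0" if "t \<in> I" for t \<theta>
  proof -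
    have "Dt I (\<Phi> 0) t \<theta> = Dt I (\<lambda>_ _. 0) t \<theta>" by (rule Dt_cong) (use zero that in auto)
    also have "\<dots> = 0" by (rule Dt_eqI) (use I that in auto)
    finally show ?thesis .
  qed
  have 2: "Dtheta (\<Phi> 0) t \<theta> = 0" if "t \<in> I" for t \<theta>
    by (rule Dtheta_eqI) (use zero that in \<open>simp\<close>)
  have 3: "Dt I (Dt I (\<Phi> 0)) t \<theta> = 0"
  proof -
    have "Dt I (Dt I (\<Phi> 0)) t \<theta> = Dt I (\<lambda>_ _. 0) t \<theta>" by (rule Dt_cong) (use 1 t in auto)
    also have "\<dots> = 0" by (rule Dt_eqI) (use I t in auto)
    finally show ?thesis .
  qed
  have 4: "Dtheta (Dt I (\<Phi> 0)) t \<theta> = 0" "Dtheta (Dtheta (\<Phi> 0)) t \<theta> = 0"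
    by (rule Dtheta_eqI; use 1 2 t in \<open>simp\<close>)+
  note lin = mc_jet_linearization[OF d zero[OF t] 1[OF t] 2[OF t] 3 4, where c = "2 * \<gamma> * \<mu> t / (x t)\<^sup>2"]
  show ?thesis
    by (rule DERIV_cong_ev[OF refl _ refl, THEN iffD2, OF _ lin], rule eventually_mono[OF \<Phi>])
      (simp add: mean_curvature_eq_mc_jet perturbed_jets[OF I _ t])
qed

text \<open>The explicit Jacobi operator:
  \<open>x^2 (k^2 + l^2) = 2 x^2 + 2 \<gamma>^2 / x^2\<close> is twice the usual potential.\<close>

definition linearized :: "real set \<Rightarrow> (real \<Rightarrow> real \<Rightarrow> real) \<Rightarrow> real \<Rightarrow> real \<Rightarrow> real" where
  "linearized I \<phi> t \<theta> = (Dt I (Dt I \<phi>) t \<theta> + Dtheta (Dtheta \<phi>) t \<theta>) / (2 * (x t)\<^sup>2)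
     + \<phi> t \<theta> * ((k t)\<^sup>2 + (l t)\<^sup>2) / 2"

lemma mean_curvature_linearized:
  assumes "\<forall>t\<in>I. at t within I \<noteq> bot" "t \<in> I"
    and "\<forall>\<^sub>F s in nhds 0. C2_cyl I (\<Phi> s)" "\<And>t \<theta>. t \<in> I \<Longrightarrow> \<Phi> 0 t \<theta> = 0"
    and d: "\<And>J. J \<in> jets I \<Longrightarrow> ((\<lambda>s. J (\<Phi> s) t \<theta>) has_real_derivative J \<psi> t \<theta>) (at 0)"
  shows "((\<lambda>s. mean_curvature I (perturbed_surface x z (p s) (q s) (\<Phi> s)) t \<theta>)
    has_real_derivative linearized I \<psi> t \<theta>) (at 0)"
  unfolding linearized_def
  by (rule mean_curvature_linearization[OF assms(1-4) d[of "\<lambda>f. f"] d[of "Dt I"] d[of Dtheta]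
      d[of "\<lambda>f. Dt I (Dt I f)"] d[of "\<lambda>f. Dtheta (Dt I f)"] d[of "\<lambda>f. Dtheta (Dtheta f)"]])
     (simp_all add: jets_def)

lemma jacobi_op_eq_linearized:
  assumes I: "\<forall>t\<in>I. at t within I \<noteq> bot" and t: "t \<in> I" and \<phi>: "C2_cyl I \<phi>"
  shows "jacobi_op I x z \<phi> t \<theta> = linearized I \<phi> t \<theta>"
proof -
  \<comment> \<open>The zero summand gives the family the form of a linear combination, as
    \<open>jet_lincomb\<close> expects.\<close>
  let ?\<Phi> = "\<lambda>s t \<theta>. s * \<phi> t \<theta> + 0 * \<phi> t \<theta>"
  have "((\<lambda>s. mean_curvature I (perturbed_surface x z 0 0 (?\<Phi> s)) t \<theta>)
    has_real_derivative linearized I \<phi> t \<theta>) (at 0)"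
  proof (rule mean_curvature_linearized[OF I t])
    show "\<forall>\<^sub>F s in nhds 0. C2_cyl I (?\<Phi> s)"
      using C2_cyl_lincomb[OF I \<phi> \<phi>] by (intro always_eventually allI)
    fix J assume J: "J \<in> jets I"
    show "((\<lambda>s. J (?\<Phi> s) t \<theta>) has_real_derivative J \<phi> t \<theta>) (at 0)"
      unfolding jet_lincomb[OF I J \<phi> \<phi> t] by (auto intro!: derivative_eq_intros)
  qed auto
  moreover have "perturbed_surface x z 0 0 (?\<Phi> s) =
      (\<lambda>t \<theta>. delaunay_surface x z t \<theta> + (s * \<phi> t \<theta>) *\<^sub>R delaunay_normal x z t \<theta>)" for s
    by (simp add: perturbed_surface_def fun_eq_iff)
  ultimately show ?thesis
    unfolding jacobi_op_def by (simp add: DERIV_imp_deriv)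
qed

text \<open>The \<theta>-derivatives vanish, and multiplication by \<open>2 x^2\<close> turns the
  Jacobi equation into a linear equation of second order in t. Keeping \<open>I\<close> general
  serves both \<open>T_set\<close> on the line and \<open>even_jacobi_solution\<close> on an
  interval.\<close>

lemma radial_jacobi_ode:
  assumes I: "\<forall>t\<in>I. at t within I \<noteq> bot" and w: "C2_cyl I (\<lambda>t \<theta>. w t)"
    and J: "\<And>t. t \<in> I \<Longrightarrow> jacobi_op I x z (\<lambda>t \<theta>. w t) t 0 = 0"
  obtains w' where "\<And>t. t \<in> I \<Longrightarrow> (w has_real_derivative w' t) (at t within I)"
    "\<And>t. t \<in> I \<Longrightarrow>
      (w' has_real_derivative - ((x t)\<^sup>2 * ((k t)\<^sup>2 + (l t)\<^sup>2) * w t)) (at t within I)"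
proof
  let ?w' = "\<lambda>t. Dt I (\<lambda>t \<theta>. w t) t 0"
  fix t assume t: "t \<in> I"
  note d = C2_cyl_derivs[OF w t, folded has_real_derivative_iff_has_vector_derivative]
  show "(w has_real_derivative ?w' t) (at t within I)" using d(1) .
  have "Dtheta (\<lambda>t \<theta>. w t) = (\<lambda>t \<theta>. 0)"
    by (intro ext Dtheta_eqI) simp
  then have "Dtheta (Dtheta (\<lambda>t \<theta>. w t)) t 0 = 0"
    by (simp add: Dtheta_def)
  then have "Dt I (Dt I (\<lambda>t \<theta>. w t)) t 0 = - ((x t)\<^sup>2 * ((k t)\<^sup>2 + (l t)\<^sup>2) * w t)"
    using J[OF t] x_nz[of t] unfolding jacobi_op_eq_linearized[OF I t w] linearized_def
    by (simp add: field_simps)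
  then show "(?w' has_real_derivative - ((x t)\<^sup>2 * ((k t)\<^sup>2 + (l t)\<^sup>2) * w t)) (at t within I)"
    using d(3)[of 0] by simp
qed

text \<open>The Fredholm condition: the right-hand side is orthogonal to the kernel element
  \<open>w\<close> with weight \<open>x^2\<close>. In the integrand, the t-part is the derivative of
  the Wronskian of \<open>w\<close> and \<psi>, which vanishes at both ends, and the \<theta>-part
  integrates to 0 over a period.\<close>

lemma jacobi_solvability:
  assumes T: "T > 0" and \<psi>: "C2_cyl {-T..T} \<psi>" and \<psi>T: "\<And>\<theta>. \<psi> T \<theta> = 0" "\<And>\<theta>. \<psi> (-T) \<theta> = 0"
    and eq: "\<And>t \<theta>. t \<in> {-T..T} \<Longrightarrow> linearized {-T..T} \<psi> t \<theta> = g t \<theta>"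
    and w: "\<And>t. t \<in> {-T..T} \<Longrightarrow> (w has_real_derivative w' t) (at t within {-T..T})"
    and w': "\<And>t. t \<in> {-T..T} \<Longrightarrow>
      (w' has_real_derivative - ((x t)\<^sup>2 * ((k t)\<^sup>2 + (l t)\<^sup>2) * w t)) (at t within {-T..T})"
    and wT: "w T = 0" "w (-T) = 0"
  shows "integral ({-T..T} \<times> {-pi..pi}) (\<lambda>(t, \<theta>). (x t)\<^sup>2 * w t * g t \<theta>) = 0"
proof -
  let ?I = "{-T..T}" and ?C = "cbox (-T, -pi) (T, pi)"
  have I: "\<forall>t\<in>?I. at t within ?I \<noteq> bot" using at_within_Icc_neq_bot[OF T] by blast
  have C: "{-T..T} \<times> {-pi..pi} = ?C" by (simp add: cbox_Pair_eq)
  \<comment> \<open>With this name, \<open>2 x^2 w\<close> times the linearized operator applied to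
    \<psi> is \<open>?F + ?G\<close>.\<close>
  define w'' where "w'' t = - ((x t)\<^sup>2 * ((k t)\<^sup>2 + (l t)\<^sup>2) * w t)" for t
  note w'' = w'[folded w''_def]
  let ?F = "\<lambda>t \<theta>. w t * Dt ?I (Dt ?I \<psi>) t \<theta> - w'' t * \<psi> t \<theta>"
  let ?G = "\<lambda>t \<theta>. w t * Dtheta (Dtheta \<psi>) t \<theta>"
  have cw: "continuous_on ?I w" using w by (rule DERIV_continuous_on)
  have cw'': "continuous_on ?I w''"
    unfolding w''_def by (intro continuous_intros cw DERIV_continuous_on[OF x_deriv]
      DERIV_continuous_on[OF k_deriv] DERIV_continuous_on[OF l_deriv])
  have fst: "continuous_on ?C (\<lambda>(t, \<theta>). f t)" if "continuous_on ?I f" for f :: "real \<Rightarrow> real"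
    unfolding case_prod_unfold
    by (rule continuous_on_compose2[OF that]) (auto intro!: continuous_intros simp: cbox_Pair_eq)
  have jet: "continuous_on ?C (\<lambda>(t, \<theta>). J \<psi> t \<theta>)" if "J \<in> jets ?I" for J
    by (rule continuous_on_subset[OF jet_continuous[OF I that \<psi>]]) (auto simp: cbox_Pair_eq)
  have J: "(\<lambda>f. f) \<in> jets ?I" "(\<lambda>f. Dt ?I (Dt ?I f)) \<in> jets ?I" "(\<lambda>f. Dtheta (Dtheta f)) \<in> jets ?I"
    "Dtheta \<in> jets ?I"
    by (simp_all add: jets_def)
  note cj = jet[OF J(1)] jet[OF J(2)] jet[OF J(3)]
  have cF: "continuous_on ?C (\<lambda>(t, \<theta>). ?F t \<theta>)"
    using fst[OF cw] fst[OF cw''] cj unfolding case_prod_unfold by (intro continuous_intros)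
  have cG: "continuous_on ?C (\<lambda>(t, \<theta>). ?G t \<theta>)"
    using fst[OF cw] cj unfolding case_prod_unfold by (intro continuous_intros)
  have F: "integral ?I (\<lambda>t. ?F t \<theta>) = 0" for \<theta>
  proof -
    note d = C2_cyl_derivs[OF \<psi>, folded has_real_derivative_iff_has_vector_derivative]
    have "((\<lambda>s. w s * Dt ?I \<psi> s \<theta> - w' s * \<psi> s \<theta>) has_real_derivative ?F t \<theta>) (at t within ?I)"
      if "t \<in> ?I" for t
      by (rule DERIV_cong[OF DERIV_diff[OF DERIV_mult[OF w[OF that] d(3)[OF that]]
          DERIV_mult[OF w''[OF that] d(1)[OF that]]]]) (simp add: algebra_simps)
    then have "((\<lambda>t. ?F t \<theta>) has_integral
        (w T * Dt ?I \<psi> T \<theta> - w' T * \<psi> T \<theta>) - (w (-T) * Dt ?I \<psi> (-T) \<theta> - w' (-T) * \<psi> (-T) \<theta>)) ?I"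
      unfolding has_real_derivative_iff_has_vector_derivative
      using T by (intro fundamental_theorem_of_calculus) simp_all
    then show ?thesis using wT \<psi>T by (simp add: integral_unique)
  qed
  have G: "integral {-pi..pi} (\<lambda>\<theta>. ?G t \<theta>) = 0" if t: "t \<in> ?I" for t
  proof -
    have "((\<lambda>\<theta>. Dtheta (Dtheta \<psi>) t \<theta>) has_integral Dtheta \<psi> t pi - Dtheta \<psi> t (-pi)) {-pi..pi}"
      by (rule fundamental_theorem_of_calculus)
        (use pi_gt_zero has_vector_derivative_at_within[OF C2_cyl_derivs(6)[OF \<psi> t]] in simp_all)
    moreover have "Dtheta \<psi> t pi = Dtheta \<psi> t (-pi)"
      using jet_periodic[OF I J(4) \<psi> t, of "-pi"] by simp
    ultimately show ?thesis by (simp add: integral_unique)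
  qed
  have "integral ?C (\<lambda>(t, \<theta>). ?F t \<theta>) = integral ?I (\<lambda>t. integral {-pi..pi} (\<lambda>\<theta>. ?F t \<theta>))"
    using integral_prod_continuous[OF cF] by simp
  \<comment> \<open>For \<open>?F\<close> the integral over t must be the inner one, for
    \<open>?G\<close> the integral over \<theta>.\<close>
  also have "\<dots> = integral {-pi..pi} (\<lambda>\<theta>. integral ?I (\<lambda>t. ?F t \<theta>))"
    using integral_swap_continuous[OF cF] by simp
  finally have iF: "integral ?C (\<lambda>(t, \<theta>). ?F t \<theta>) = 0" by (simp add: F)
  have "integral ?C (\<lambda>(t, \<theta>). ?G t \<theta>) = integral ?I (\<lambda>t. integral {-pi..pi} (\<lambda>\<theta>. ?G t \<theta>))"
    using integral_prod_continuous[OF cG] by simp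
  also have "\<dots> = integral ?I (\<lambda>t. 0)" by (rule integral_cong) (rule G)
  finally have iG: "integral ?C (\<lambda>(t, \<theta>). ?G t \<theta>) = 0" by simp
  have "integral ?C (\<lambda>(t, \<theta>). (x t)\<^sup>2 * w t * g t \<theta>) =
      integral ?C (\<lambda>p. ((\<lambda>(t, \<theta>). ?F t \<theta>) p + (\<lambda>(t, \<theta>). ?G t \<theta>) p) / 2)"
  proof (rule integral_cong)
    fix p assume "p \<in> ?C"
    then obtain t \<theta> where p: "p = (t, \<theta>)" "t \<in> ?I" by (auto simp: cbox_Pair_eq)
    show "(\<lambda>(t, \<theta>). (x t)\<^sup>2 * w t * g t \<theta>) p = ((\<lambda>(t, \<theta>). ?F t \<theta>) p + (\<lambda>(t, \<theta>). ?G t \<theta>) p) / 2"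
      using x_nz[of t] unfolding p(1) prod.case eq[OF p(2), symmetric] linearized_def w''_def
      by (simp add: field_simps)
  qed
  also have "\<dots> = 0"
    using integral_add[OF integrable_continuous[OF cF] integrable_continuous[OF cG]] iF iG by simp
  finally show ?thesis unfolding C .
qed

text \<open>Both sides of the mean curvature equation are differentiated at parameter 0, and
  uniqueness of derivatives equates the results. Here \<psi> is the derivative of the branch; its
  boundary values vanish because those of the branch do near 0.\<close>

lemma solution_branch_linearized:
  assumes T: "T > 0" and H: "C1_map (\<lambda>(\<epsilon>, v). H \<epsilon> v)" "\<And>v. H 0 v = 1"
    and \<delta>: "\<delta> > 0" and branch: "solution_branch x z H T p0 q0 \<delta> p q \<phi>"
  obtains \<psi> where "C2_cyl {-T..T} \<psi>" "\<And>\<theta>. \<psi> T \<theta> = 0" "\<And>\<theta>. \<psi> (-T) \<theta> = 0"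
    "\<And>t \<theta>. t \<in> {-T..T} \<Longrightarrow> linearized {-T..T} \<psi> t \<theta> =
       deriv (\<lambda>\<epsilon>. H \<epsilon> (delaunay_surface x z t \<theta> + p0 *\<^sub>R axis 1 1 + q0 *\<^sub>R axis 2 1)) 0"
proof -
  let ?I = "{-T..T}"
  have I: "\<forall>t\<in>?I. at t within ?I \<noteq> bot" using at_within_Icc_neq_bot[OF T] by blast
  note br = branch[unfolded solution_branch_def]
  have pq: "continuous_on {-\<delta>..\<delta>} (\<lambda>\<epsilon>. (p \<epsilon>, q \<epsilon>))" and curve: "C1_curve_in_C2 {-\<delta>..\<delta>} ?I \<phi>"
    and pq0: "p 0 = p0" "q 0 = q0" and \<phi>0: "\<And>t \<theta>. t \<in> ?I \<Longrightarrow> \<phi> 0 t \<theta> = 0"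
    and sol: "\<And>\<epsilon>. \<epsilon> \<in> {-\<delta><..<\<delta>} \<Longrightarrow> solves_H_problem x z T (H \<epsilon>) (p \<epsilon>) (q \<epsilon>) (\<phi> \<epsilon>)"
    using br by auto
  have near: "\<forall>\<^sub>F \<epsilon> in nhds 0. \<epsilon> \<in> {-\<delta><..<\<delta>}"
    using \<delta> by (intro eventually_nhds_in_open) auto
  obtain \<psi> where \<psi>: "C2_cyl ?I \<psi>" and d: "\<And>J t \<theta>. J \<in> jets ?I \<Longrightarrow> t \<in> ?I \<Longrightarrow>
      ((\<lambda>e. J (\<phi> e) t \<theta>) has_real_derivative J \<psi> t \<theta>) (at 0)"
    using C1_curve_jet_derivative[OF I compact_Icc \<delta> curve] by blast
  have d0: "((\<lambda>e. \<phi> e t \<theta>) has_real_derivative \<psi> t \<theta>) (at 0)" if "t \<in> ?I" for t \<theta>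
    using d[of "\<lambda>f. f", OF _ that] by (simp add: jets_def)
  have bd: "\<psi> t \<theta> = 0" if "t = T \<or> t = -T" for t \<theta>
  proof (rule DERIV_unique[OF d0])
    show "t \<in> ?I" using that T by auto
    have "\<forall>\<^sub>F \<epsilon> in nhds 0. \<phi> \<epsilon> t \<theta> = 0"
      using near by (rule eventually_mono) (use sol that in \<open>auto simp: solves_H_problem_def\<close>)
    then show "((\<lambda>e. \<phi> e t \<theta>) has_real_derivative 0) (at 0)"
      by (subst DERIV_cong_ev[OF refl _ refl]) auto
  qed
  show ?thesis
  proof (rule that[OF \<psi>])
    fix t \<theta> assume t: "t \<in> ?I"
    let ?Y = "\<lambda>\<epsilon>. perturbed_surface x z (p \<epsilon>) (q \<epsilon>) (\<phi> \<epsilon>) t \<theta>"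
    have "((\<lambda>\<epsilon>. mean_curvature ?I (perturbed_surface x z (p \<epsilon>) (q \<epsilon>) (\<phi> \<epsilon>)) t \<theta>)
        has_real_derivative linearized ?I \<psi> t \<theta>) (at 0)"
    proof (rule mean_curvature_linearized[OF I t])
      show "\<forall>\<^sub>F s in nhds 0. C2_cyl ?I (\<phi> s)"
        using near by (rule eventually_mono) (use curve in \<open>auto simp: C1_curve_in_C2_def\<close>)
    qed (use \<phi>0 d t in auto)
    moreover have "\<forall>\<^sub>F \<epsilon> in nhds 0.
        mean_curvature ?I (perturbed_surface x z (p \<epsilon>) (q \<epsilon>) (\<phi> \<epsilon>)) t \<theta> = H \<epsilon> (?Y \<epsilon>)"
      using near by (rule eventually_mono) (use sol t in \<open>auto simp: solves_H_problem_def\<close>)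
    ultimately have 1: "((\<lambda>\<epsilon>. H \<epsilon> (?Y \<epsilon>)) has_real_derivative linearized ?I \<psi> t \<theta>) (at 0)"
      by (rule DERIV_cong_ev[OF refl _ refl, THEN iffD1, rotated])
    \<comment> \<open>Only continuity of the surface point in the parameter is available, which is
      what \<open>C1_map_param_deriv_along\<close> asks for.\<close>
    have "isCont (\<lambda>\<epsilon>. (p \<epsilon>, q \<epsilon>)) 0"
      by (rule continuous_on_interior[OF pq]) (use \<delta> in simp)
    then have "isCont p 0" "isCont q 0"
      using isCont_fst[of 0 "\<lambda>\<epsilon>. (p \<epsilon>, q \<epsilon>)"] isCont_snd[of 0 "\<lambda>\<epsilon>. (p \<epsilon>, q \<epsilon>)"] by simp_all
    moreover have "isCont (\<lambda>e. \<phi> e t \<theta>) 0" using d0[OF t] by (rule DERIV_isCont)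
    ultimately have "isCont ?Y 0"
      unfolding perturbed_surface_def by (intro continuous_intros)
    from C1_map_param_deriv_along[OF H this]
    have "((\<lambda>\<epsilon>. H \<epsilon> (?Y \<epsilon>)) has_real_derivative deriv (\<lambda>\<epsilon>. H \<epsilon> (?Y 0)) 0) (at 0)" .
    moreover have "?Y 0 = delaunay_surface x z t \<theta> + p0 *\<^sub>R axis 1 1 + q0 *\<^sub>R axis 2 1"
      by (simp add: perturbed_surface_def pq0 \<phi>0[OF t])
    ultimately show "linearized ?I \<psi> t \<theta> =
       deriv (\<lambda>\<epsilon>. H \<epsilon> (delaunay_surface x z t \<theta> + p0 *\<^sub>R axis 1 1 + q0 *\<^sub>R axis 2 1)) 0"
      using DERIV_unique[OF 1] by simp
  qed (use bd in auto)
qed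

lemma T_set_least_zero_free:
  assumes T: "T \<in> T_set x z" "\<And>s. s \<in> T_set x z \<Longrightarrow> T \<le> s"
  obtains w w' where "\<And>t S. (w has_real_derivative w' t) (at t within S)"
    "\<And>t S. (w' has_real_derivative - ((x t)\<^sup>2 * ((k t)\<^sup>2 + (l t)\<^sup>2) * w t)) (at t within S)"
    "w T = 0" "w (-T) = 0" "\<And>t. w (-t) = w t" "\<And>t. t \<in> {0<..<T} \<Longrightarrow> w t \<noteq> 0"
proof -
  from T(1) obtain w where w: "w C1_differentiable_on UNIV" "deriv w C1_differentiable_on UNIV"
    "\<forall>t. w (-t) = w t" "\<exists>t. w t \<noteq> 0" "\<forall>t \<theta>. jacobi_op UNIV x z (\<lambda>t \<theta>. w t) t \<theta> = 0" "w T = 0"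
    by (auto simp: T_set_def)
  obtain w' where w': "\<And>t. (w has_real_derivative w' t) (at t)"
    "\<And>t. (w' has_real_derivative - ((x t)\<^sup>2 * ((k t)\<^sup>2 + (l t)\<^sup>2) * w t)) (at t)"
    using radial_jacobi_ode[OF _ C2_cyl_radial[OF w(1,2)]] w(5) by auto
  have "w s \<noteq> 0" if "s \<in> {0<..<T}" for s
  proof
    assume "w s = 0"
    \<comment> \<open>The same field \<open>w\<close> witnesses that \<open>s\<close> belongs to the
      set.\<close>
    with w that have "s \<in> T_set x z" by (auto simp: T_set_def)
    with T(2) that show False by fastforce
  qed
  with w(3,6) w' show ?thesis
    by (intro that[of w w']) (auto intro: has_field_derivative_at_within)
qed

section \<open>Non-existence of solution branches\<close>

lemma no_branch_if_not_orthogonal: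
  assumes T: "T > 0" and H: "C1_map (\<lambda>(\<epsilon>, v). H \<epsilon> v)" "\<And>v. H 0 v = 1"
    and w: "\<And>t. t \<in> {-T..T} \<Longrightarrow> (w has_real_derivative w' t) (at t within {-T..T})"
      "\<And>t. t \<in> {-T..T} \<Longrightarrow>
        (w' has_real_derivative - ((x t)\<^sup>2 * ((k t)\<^sup>2 + (l t)\<^sup>2) * w t)) (at t within {-T..T})"
      "w T = 0" "w (-T) = 0"
    and int: "integral ({-T..T} \<times> {-pi..pi}) (\<lambda>(t, \<theta>). (x t)\<^sup>2 * w t *
      deriv (\<lambda>\<epsilon>. H \<epsilon> (delaunay_surface x z t \<theta> + p0 *\<^sub>R axis 1 1 + q0 *\<^sub>R axis 2 1)) 0) \<noteq> 0"
  shows "\<not> (\<exists>\<delta>>0. \<exists>p q \<phi>. solution_branch x z H T p0 q0 \<delta> p q \<phi>)"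
proof clarify
  fix \<delta> p q \<phi> assume "\<delta> > 0" "solution_branch x z H T p0 q0 \<delta> p q \<phi>"
  from solution_branch_linearized[OF T H this] obtain \<psi> where
    "C2_cyl {-T..T} \<psi>" "\<And>\<theta>. \<psi> T \<theta> = 0" "\<And>\<theta>. \<psi> (-T) \<theta> = 0"
    "\<And>t \<theta>. t \<in> {-T..T} \<Longrightarrow> linearized {-T..T} \<psi> t \<theta> =
       deriv (\<lambda>\<epsilon>. H \<epsilon> (delaunay_surface x z t \<theta> + p0 *\<^sub>R axis 1 1 + q0 *\<^sub>R axis 2 1)) 0"
    by metis
  from jacobi_solvability[OF T this w] int show False by simp
qed

lemma no_branch_least_T:
  assumes T: "T \<in> T_set x z" "\<And>s. s \<in> T_set x z \<Longrightarrow> T \<le> s"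
    and H: "C1_map (\<lambda>(\<epsilon>, v). H \<epsilon> v)" "\<And>v. H 0 v = 1"
    and nz: "\<And>v. deriv (\<lambda>\<epsilon>. H \<epsilon> v) 0 \<noteq> 0"
  shows "\<not> (\<exists>\<delta>>0. \<exists>p q \<phi>. solution_branch x z H T p0 q0 \<delta> p q \<phi>)"
proof -
  have T0: "T > 0" using T(1) by (simp add: T_set_def)
  obtain w w' where w: "\<And>t S. (w has_real_derivative w' t) (at t within S)"
    "\<And>t S. (w' has_real_derivative - ((x t)\<^sup>2 * ((k t)\<^sup>2 + (l t)\<^sup>2) * w t)) (at t within S)"
    "w T = 0" "w (-T) = 0" "\<And>t. w (-t) = w t" "\<And>t. t \<in> {0<..<T} \<Longrightarrow> w t \<noteq> 0"
    by (rule T_set_least_zero_free[OF T]) (assumption | rule that)+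
  define h where "h v = deriv (\<lambda>\<epsilon>. H \<epsilon> v) 0" for v
  define Y where "Y t \<theta> = delaunay_surface x z t \<theta> + p0 *\<^sub>R axis 1 1 + q0 *\<^sub>R axis 2 1" for t \<theta>
  \<comment> \<open>\<open>c\<close> absorbs the unknown signs: \<open>h\<close> has one sign on the
    connected space and \<open>w\<close> does not change sign on the interval, so \<open>c\<close>
    times the integrand is nonnegative.\<close>
  define c where "c = w (T / 2) * h 0"
  let ?C = "cbox (-T, -pi) (T, pi)"
  let ?F = "\<lambda>(t, \<theta>). (x t)\<^sup>2 * w t * h (Y t \<theta>)"
  have half: "T / 2 \<in> {0<..<T}" using T0 by simp
  have h0: "h v \<noteq> 0" for v using nz by (simp add: h_def)
  have ch: "continuous_on UNIV h"
    unfolding h_def by (rule C1_map_param_deriv_continuous[OF H])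
  have cw: "continuous_on S w" and cx: "continuous_on S x" and cz: "continuous_on S z" for S
    by (rule DERIV_continuous_on, rule w(1) x_deriv z_deriv)+
  have cY: "continuous_on UNIV (\<lambda>p. Y (fst p) (snd p))"
    unfolding Y_def delaunay_surface_frame e_rad_def
    by (intro continuous_intros continuous_on_compose2[OF cx] continuous_on_compose2[OF cz]) auto
  have cF: "continuous_on ?C ?F"
    unfolding case_prod_unfold
    by (intro continuous_intros continuous_on_compose2[OF cx] continuous_on_compose2[OF cw]
      continuous_on_compose2[OF ch] continuous_on_subset[OF cY]) auto
  have "c * ?F p \<ge> 0" if C: "p \<in> ?C" for p
  proof -
    obtain t \<theta> where p: "p = (t, \<theta>)" "t \<in> {-T..T}" using C by (auto simp: cbox_Pair_eq)
    have "w t * w (T / 2) \<ge> 0"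
      using even_same_sign_on_Icc[OF cw w(5,3,6) half p(2)] .
    moreover have "h 0 * h (Y t \<theta>) > 0"
      by (rule connected_nonzero_same_sign[OF ch]) (auto simp: h0)
    ultimately have "(x t)\<^sup>2 * (w t * w (T / 2)) * (h 0 * h (Y t \<theta>)) \<ge> 0" by simp
    then show ?thesis by (simp add: p(1) c_def mult_ac)
  qed
  moreover have "continuous_on ?C (\<lambda>p. c * ?F p)" by (intro continuous_intros cF)
  moreover have "box (-T, -pi) (T, pi) \<noteq> {}"
    using T0 by (auto simp: box_ne_empty Basis_prod_def)
  \<comment> \<open>A continuous nonnegative function that is nonzero at one point of the box has a
    nonzero integral.\<close>
  moreover have "c * ?F (T / 2, 0) \<noteq> 0"
    using w(6)[OF half] h0 x_nz by (simp add: c_def)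
  moreover have "(T / 2, 0) \<in> ?C" using T0 by (simp add: cbox_Pair_eq)
  ultimately have "integral ?C (\<lambda>p. c * ?F p) \<noteq> 0"
    using integral_cbox_eq_0_iff[of "(-T, -pi)" "(T, pi)" "\<lambda>p. c * ?F p"] by blast
  then have "integral ?C ?F \<noteq> 0" by auto
  moreover have "{-T..T} \<times> {-pi..pi} = ?C" by (simp add: cbox_Pair_eq)
  ultimately show ?thesis
    by (intro no_branch_if_not_orthogonal[OF T0 H w(1-4)]) (simp add: h_def Y_def)
qed

text \<open>Here \<open>w\<close> is given on \<open>{-T..T}\<close>, so its differential equation
  is obtained with derivatives within that interval; its boundary values come from
  \<open>X_space\<close>.\<close>

lemma no_branch_even_jacobi_solution:
  assumes T: "T > 0" and H: "C1_map (\<lambda>(\<epsilon>, v). H \<epsilon> v)" "\<And>v. H 0 v = 1"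
    and w: "even_jacobi_solution \<alpha> x z T w"
    and int: "integral ({-T..T} \<times> {-pi..pi}) (\<lambda>(t, \<theta>). (x t)\<^sup>2 * w t *
      deriv (\<lambda>\<epsilon>. H \<epsilon> (delaunay_surface x z t \<theta> + p0 *\<^sub>R axis 1 1 + q0 *\<^sub>R axis 2 1)) 0) \<noteq> 0"
  shows "\<not> (\<exists>\<delta>>0. \<exists>p q \<phi>. solution_branch x z H T p0 q0 \<delta> p q \<phi>)"
proof -
  have "\<forall>t\<in>{-T..T}. at t within {-T..T} \<noteq> bot" using at_within_Icc_neq_bot[OF T] by blast
  moreover have "C2_cyl {-T..T} (\<lambda>t \<theta>. w t)" and bd: "w T = 0" "w (-T) = 0"
    using w by (auto simp: even_jacobi_solution_def X_space_def C2_holder_cyl_def)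
  moreover have "\<And>t. t \<in> {-T..T} \<Longrightarrow> jacobi_op {-T..T} x z (\<lambda>t \<theta>. w t) t 0 = 0"
    using w unfolding even_jacobi_solution_def by blast
  ultimately obtain w' where "\<And>t. t \<in> {-T..T} \<Longrightarrow> (w has_real_derivative w' t) (at t within {-T..T})"
    "\<And>t. t \<in> {-T..T} \<Longrightarrow>
      (w' has_real_derivative - ((x t)\<^sup>2 * ((k t)\<^sup>2 + (l t)\<^sup>2) * w t)) (at t within {-T..T})"
    using radial_jacobi_ode by metis
  from no_branch_if_not_orthogonal[OF T H this bd int] show ?thesis .
qed

end

theorem theorem1p3:
  fixes a \<alpha> p0 q0 :: real
    and x z :: "real \<Rightarrow> real"
    and Ts :: "nat \<Rightarrow> real"
    and H :: "real \<Rightarrow> real^3 \<Rightarrow> real"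
  assumes "a \<in> {-1<..<0} \<union> {0<..}"
    and "\<alpha> \<in> {0<..<1}"
    and "delaunay_profile a x z"
    and "T_enumeration x z Ts"
    and "C1_map (\<lambda>(\<epsilon>, v). H \<epsilon> v)"
    and "\<And>v. H 0 v = 1"
  shows "((\<forall>v. deriv (\<lambda>\<epsilon>. H \<epsilon> v) 0 \<noteq> 0) \<longrightarrow>
            \<not> (\<exists>\<delta>>0. \<exists>p q \<phi>. solution_branch x z H (Ts 0) p0 q0 \<delta> p q \<phi>)) \<and>
         (\<forall>k\<ge>1. \<forall>w.
            even_jacobi_solution \<alpha> x z (Ts k) w \<and>
            integral ({-Ts k..Ts k} \<times> {-pi..pi})
              (\<lambda>(t, \<theta>). (x t)\<^sup>2 * w t *
                 deriv (\<lambda>\<epsilon>. H \<epsilon> (delaunay_surface x z t \<theta> + p0 *\<^sub>R axis 1 1 + q0 *\<^sub>R axis 2 1)) 0) \<noteq> 0 \<longrightarrow>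
            \<not> (\<exists>\<delta>>0. \<exists>p q \<phi>. solution_branch x z H (Ts k) p0 q0 \<delta> p q \<phi>))"
proof -
  interpret delaunay a x z
    using assms(1,3) by unfold_locales
  have Ts: "Ts k \<in> T_set x z" for k
    using assms(4) by (auto simp: T_enumeration_def)
  \<comment> \<open>An increasing enumeration starts at the least element, which is where the sign
    argument applies.\<close>
  have least: "Ts 0 \<le> s" if "s \<in> T_set x z" for s
    using assms(4) that unfolding T_enumeration_def
    by (metis imageE less_eq_nat.simps(1) strict_mono_less_eq)
  show ?thesis
  proof (intro conjI impI allI)
    assume "\<forall>v. deriv (\<lambda>\<epsilon>. H \<epsilon> v) 0 \<noteq> 0"
    then show "\<not> (\<exists>\<delta>>0. \<exists>p q \<phi>. solution_branch x z H (Ts 0) p0 q0 \<delta> p q \<phi>)"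
      by (intro no_branch_least_T[OF Ts least assms(5,6)]) blast+
  next
    fix k w
    assume w: "even_jacobi_solution \<alpha> x z (Ts k) w \<and>
      integral ({-Ts k..Ts k} \<times> {-pi..pi})
        (\<lambda>(t, \<theta>). (x t)\<^sup>2 * w t *
           deriv (\<lambda>\<epsilon>. H \<epsilon> (delaunay_surface x z t \<theta> + p0 *\<^sub>R axis 1 1 + q0 *\<^sub>R axis 2 1)) 0) \<noteq> 0"
    have "Ts k > 0" using Ts[of k] by (simp add: T_set_def)
    from no_branch_even_jacobi_solution[OF this assms(5,6) conjunct1[OF w] conjunct2[OF w]]
    show "\<not> (\<exists>\<delta>>0. \<exists>p q \<phi>. solution_branch x z H (Ts k) p0 q0 \<delta> p q \<phi>)" .
  qed
qed

end
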